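(* The following two identities hold: \begin{align*} (q)_\infty (\chi_0(q) - 2) &=\sum_{j=0}^\infty \ \sum_{-j \le 3m \le j} \operatorname{sgn}(m) (-1)^{m+j+1} q^{ j(3j+1)/2 - m(15m+1)/2 }(1-q^{2j+1})\\ &\quad+ \sum_{j=1}^\infty \ \sum_{-j-1 \le 3m \le j-1} \operatorname{sgn}(m) (-1)^{m+j+1} q^{ j(3j+1)/2 - m(15m+11)/2 -1}(1-q^{2j+1}), \end{align*} and \begin{align*} (q)_\infty \chi_1(q) &=\sum_{j=1}^\infty \ \sum_{-j \le 3m \le j-1} \operatorname{sgn}(m) (-1)^{m+j+1} q^{ j(3j-1)/2 - m(15m+7)/2 -1}(1+q^{j})\\ &\quad+ \sum_{j=1}^\infty \ \sum_{-j-1 \le 3m \le j-2} \operatorname{sgn}(m) (-1)^{m+j+1} q^{ j(3j-1)/2 - m(15m+13)/2 -2}(1+q^{j}). \end{align*} In each inner sum $m$ ranges over all integers (possibly negative) satisfying the indicated inequalities.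
   Context: The identities are between power series in $q$ (formal, or convergent for $|q|<1$). Notation: for a nonnegative integer $n$, $(a;q)_n=(1-a)(1-aq)\cdots(1-aq^{n-1})$, and $(q)_\infty=\prod_{n=1}^\infty(1-q^n)$. Ramanujan's fifth order mock theta functions $\chi_0,\chi_1$ are $$\chi_0(q)=\sum_{n=0}^\infty \frac{q^n}{(q^{n+1};q)_n},\qquad \chi_1(q)=\sum_{n=0}^\infty \frac{q^n}{(q^{n+1};q)_{n+1}}.$$ The sign function is $\operatorname{sgn}(m)=1$ if $m\ge 0$ and $\operatorname{sgn}(m)=-1$ if $m<0$. *)

theory Defs
  imports "HOL-Analysis.Analysis"
begin

definition qpoch :: "complex \<Rightarrow> complex \<Rightarrow> nat \<Rightarrow> complex" where
  "qpoch a q n = (\<Prod>k<n. 1 - a * q ^ k)"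

definition qpoch_inf :: "complex \<Rightarrow> complex" where
  "qpoch_inf q = (\<Prod>n. 1 - q ^ Suc n)"

definition chi0 :: "complex \<Rightarrow> complex" where
  "chi0 q = (\<Sum>\<^sub>\<infinity>n::nat. q ^ n / qpoch (q ^ (n + 1)) q n)"

definition chi1 :: "complex \<Rightarrow> complex" where
  "chi1 q = (\<Sum>\<^sub>\<infinity>n::nat. q ^ n / qpoch (q ^ (n + 1)) q (n + 1))"

text \<open>Unlike the library's \<^const>\<open>sgn\<close>, this sign function takes the value 1 at 0.\<close>

definition sg :: "int \<Rightarrow> complex" where
  "sg m = (if m \<ge> 0 then 1 else -1)"

text \<open>
  The identities are stated for complex \<open>q\<close> with \<open>norm q < 1\<close>. The lemmas below show that
  the product and all the infinite sums involved converge and that no denominator vanishes, so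
  that no expression takes a default value. The exponents, written with \<open>div\<close> on
  integers, are exact because the products divided by 2 are even, and they are
  nonnegative, so only ordinary powers of \<open>q\<close> occur.
\<close>

lemma qpoch_inf_has_prod:
  assumes "norm q < 1"
  shows "(\<lambda>n. 1 - q ^ Suc n) has_prod qpoch_inf q"
proof -
  have "summable (\<lambda>n. norm q ^ Suc n)"
    using assms by (subst summable_Suc_iff) (simp add: summable_geometric)
  moreover have "norm ((1 - q ^ Suc n) - 1) = norm q ^ Suc n" for n
    by (simp only: norm_power[symmetric] norm_minus_cancel[symmetric, of "q ^ Suc n"] diff_diff_eq2) simp
  ultimately have "summable (\<lambda>n. norm ((1 - q ^ Suc n) - 1))"
    by (simp only:)
  hence "convergent_prod (\<lambda>n. 1 - q ^ Suc n)"
    by (rule abs_convergent_prod_imp_convergent_prod[OF summable_imp_abs_convergent_prod])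
  thus ?thesis
    unfolding qpoch_inf_def by (rule convergent_prod_has_prod)
qed

lemma qpoch_nonzero:
  assumes "norm q < 1"
  shows "qpoch (q ^ (n + 1)) q k \<noteq> 0"
proof
  assume "qpoch (q ^ (n + 1)) q k = 0"
  then obtain i where "q ^ (n + 1) * q ^ i = 1"
    by (auto simp: qpoch_def)
  hence "norm q ^ (n + 1 + i) = 1"
    by (metis norm_one norm_power power_add)
  moreover have "norm q ^ (n + 1 + i) < 1"
    using assms by (subst power_less_one_iff) auto
  ultimately show False by simp
qed

lemma chi_summable_aux:
  assumes q: "norm q < 1" and k: "\<And>n. k n \<le> n + 1"
  shows "(\<lambda>n::nat. q ^ n / qpoch (q ^ (n + 1)) q (k n)) summable_on UNIV"
proof -
  define r where "r = norm q"
  define c where "c = (1 + r) / 2"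
  have r: "0 \<le> r" "r < 1"
    using q by (auto simp: r_def)
  hence c: "0 < c" "c < 1" "r < c"
    by (auto simp: c_def)
  have "(\<lambda>n. r ^ n) \<longlonglongrightarrow> 0"
    using r by (intro LIMSEQ_realpow_zero)
  hence ev: "eventually (\<lambda>n. r ^ n < 1 - c) sequentially"
    using c by (intro order_tendstoD) auto
  have "summable (\<lambda>n. norm (q ^ n / qpoch (q ^ (n + 1)) q (k n)))"
  proof (rule summable_comparison_test_ev)
    show "summable (\<lambda>n. (r / c) ^ n * (1 / c))"
      using r c by (intro summable_mult2 summable_geometric) auto
    show "eventually (\<lambda>n. norm (norm (q ^ n / qpoch (q ^ (n + 1)) q (k n)))
            \<le> (r / c) ^ n * (1 / c)) sequentially"
      using ev
    proof eventually_elim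
      case (elim n)
      have fac: "norm (1 - q ^ (n + 1) * q ^ i) \<ge> c" for i
      proof -
        have "norm (q ^ (n + 1) * q ^ i) = r ^ (n + 1 + i)"
          by (simp add: r_def norm_mult norm_power power_add)
        also have "\<dots> \<le> r ^ n"
          using r by (intro power_decreasing) auto
        finally show ?thesis
          using elim norm_triangle_ineq2[of 1 "q ^ (n + 1) * q ^ i"] by simp
      qed
      have "c ^ (n + 1) \<le> c ^ k n"
        using c k by (intro power_decreasing) auto
      also have "\<dots> = (\<Prod>i<k n. c)"
        by simp
      also have "\<dots> \<le> (\<Prod>i<k n. norm (1 - q ^ (n + 1) * q ^ i))"
        using fac c by (intro prod_mono) auto
      also have "\<dots> = norm (qpoch (q ^ (n + 1)) q (k n))"
        by (simp add: qpoch_def prod_norm)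
      finally have le: "c ^ (n + 1) \<le> norm (qpoch (q ^ (n + 1)) q (k n))" .
      have pos: "0 < c ^ (n + 1)"
        using c by simp
      have "norm (q ^ n / qpoch (q ^ (n + 1)) q (k n)) \<le> r ^ n / c ^ (n + 1)"
        unfolding norm_divide norm_power r_def[symmetric]
        by (intro divide_left_mono mult_pos_pos le pos less_le_trans[OF pos le]
              zero_le_power r(1))
      thus ?case
        using c by (simp add: power_divide mult.commute)
    qed
  qed
  thus ?thesis
    by (rule norm_summable_imp_summable_on)
qed

lemma chi0_summable:
  "norm q < 1 \<Longrightarrow> (\<lambda>n::nat. q ^ n / qpoch (q ^ (n + 1)) q n) summable_on UNIV"
  by (rule chi_summable_aux) auto

lemma chi1_summable:
  "norm q < 1 \<Longrightarrow> (\<lambda>n::nat. q ^ n / qpoch (q ^ (n + 1)) q (n + 1)) summable_on UNIV"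
  by (rule chi_summable_aux) auto

lemma hecke_summable:
  fixes b :: "nat \<Rightarrow> int \<Rightarrow> complex" and e :: "nat \<Rightarrow> int \<Rightarrow> int"
  assumes q: "norm q < 1"
    and M: "\<And>j. j \<in> A \<Longrightarrow> M j \<subseteq> {- int j - 1..int j + 1}"
    and b: "\<And>j m. j \<in> A \<Longrightarrow> m \<in> M j \<Longrightarrow> norm (b j m) \<le> 1"
    and d: "\<And>j. j \<in> A \<Longrightarrow> norm (d j) \<le> 2"
    and e: "\<And>j m. j \<in> A \<Longrightarrow> m \<in> M j \<Longrightarrow> e j m \<ge> 0 \<and> e j m \<ge> int j - 1"
  shows "(\<lambda>j. \<Sum>m\<in>M j. b j m * q powi e j m * d j) summable_on A"
proof -
  define r where "r = norm q"
  have r: "0 \<le> r" "r < 1"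
    using q by (auto simp: r_def)
  have "summable (\<lambda>j. real (Suc j) * r ^ j)"
    using r geometric_deriv_sums[of r] sums_summable by auto
  hence "summable (\<lambda>j. real (Suc (Suc j)) * r ^ j)"
  proof -
    assume "summable (\<lambda>j. real (Suc j) * r ^ j)"
    hence "summable (\<lambda>j. real (Suc j) * r ^ j + r ^ j)"
      using r by (intro summable_add summable_geometric) auto
    thus ?thesis by (simp add: algebra_simps)
  qed
  hence "summable (\<lambda>j. 6 * (real (Suc (Suc j)) * r ^ j))"
    by (rule summable_mult)
  hence "summable (\<lambda>j. 6 * (real (Suc (Suc (j - 1))) * r ^ (j - 1)))"
    using summable_iff_shift[of "\<lambda>j. 6 * (real (Suc (Suc (j - 1))) * r ^ (j - 1))" 1] by simp
  hence *: "summable (\<lambda>j. norm (6 * (real (Suc (Suc (j - 1))) * r ^ (j - 1))))"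
    using r by simp
  have "(\<lambda>j. norm (6 * (real (Suc (Suc (j - 1))) * r ^ (j - 1)))) summable_on UNIV"
    using * by (intro norm_summable_imp_summable_on) simp
  hence S: "(\<lambda>j. norm (6 * (real (Suc (Suc (j - 1))) * r ^ (j - 1)))) summable_on A"
    by (rule summable_on_subset_banach) auto
  have "(\<lambda>j. norm (\<Sum>m\<in>M j. b j m * q powi e j m * d j)) summable_on A"
  proof (rule Infinite_Sum.abs_summable_on_comparison_test[OF S])
    fix j assume j: "j \<in> A"
    have "norm (\<Sum>m\<in>M j. b j m * q powi e j m * d j) \<le> (\<Sum>m\<in>M j. 2 * r ^ (j - 1))"
    proof (rule sum_norm_le)
      fix m assume m: "m \<in> M j"
      have "norm (q powi e j m) = r ^ nat (e j m)"
        using e[OF j m] by (simp add: r_def power_int_def norm_power)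
      also have "\<dots> \<le> r ^ (j - 1)"
        using e[OF j m] r by (intro power_decreasing) auto
      finally have "norm (b j m) * norm (q powi e j m) * norm (d j) \<le> 1 * r ^ (j - 1) * 2"
        using b[OF j m] d[OF j] r by (intro mult_mono) auto
      thus "norm (b j m * q powi e j m * d j) \<le> 2 * r ^ (j - 1)"
        by (simp add: norm_mult)
    qed
    also have "\<dots> = real (card (M j)) * (2 * r ^ (j - 1))"
      by simp
    also have "card (M j) \<le> 2 * j + 3"
    proof -
      have "card (M j) \<le> card {- int j - 1..int j + 1}"
        using M[OF j] by (intro card_mono) auto
      thus ?thesis by simp
    qed
    hence "real (card (M j)) \<le> real (3 * Suc (Suc (j - 1)))"
      by (intro of_nat_mono) auto
    hence "real (card (M j)) * (2 * r ^ (j - 1)) \<le> (3 * real (Suc (Suc (j - 1)))) * (2 * r ^ (j - 1))"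
      using r by (intro mult_right_mono) simp_all
    finally show "norm (\<Sum>m\<in>M j. b j m * q powi e j m * d j)
        \<le> norm (6 * (real (Suc (Suc (j - 1))) * r ^ (j - 1)))"
      using r by (simp add: abs_mult algebra_simps)
  qed
  thus ?thesis
    by (rule abs_summable_summable)
qed

lemma exponent_lower_bound:
  fixes j m c d s l :: int
  assumes "2 * l + 2 * s \<le> j * (3 * j + c) - m * (15 * m + d)" "odd c" "odd d"
  shows "l \<le> j * (3 * j + c) div 2 - m * (15 * m + d) div 2 - s"
proof -
  have "even (j * (3 * j + c))" "even (m * (15 * m + d))"
    using assms(2,3) by auto
  then obtain u v where "j * (3 * j + c) = 2 * u" "m * (15 * m + d) = 2 * v"
    by (elim evenE)
  thus ?thesis using assms(1) by simp
qed

lemma exponents_bound: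
  fixes j m :: int
  shows "j \<ge> 0 \<Longrightarrow> - j \<le> 3 * m \<Longrightarrow> 3 * m \<le> j \<Longrightarrow>
           j \<le> j * (3 * j + 1) div 2 - m * (15 * m + 1) div 2"
    and "j \<ge> 1 \<Longrightarrow> - j - 1 \<le> 3 * m \<Longrightarrow> 3 * m \<le> j - 1 \<Longrightarrow>
           j - 1 \<le> j * (3 * j + 1) div 2 - m * (15 * m + 11) div 2 - 1"
    and "j \<ge> 1 \<Longrightarrow> - j \<le> 3 * m \<Longrightarrow> 3 * m \<le> j - 1 \<Longrightarrow>
           j - 1 \<le> j * (3 * j - 1) div 2 - m * (15 * m + 7) div 2 - 1"
    and "j \<ge> 1 \<Longrightarrow> - j - 1 \<le> 3 * m \<Longrightarrow> 3 * m \<le> j - 2 \<Longrightarrow>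
           j - 1 \<le> j * (3 * j - 1) div 2 - m * (15 * m + 13) div 2 - 2"
proof -
  have sq: "x * x \<ge> x" for x :: int
    using zero_le_power2[of x] by (cases "x \<le> 0") (auto simp: mult_le_cancel_right1 intro: order_trans[of _ 0])
  show "j \<le> j * (3 * j + 1) div 2 - m * (15 * m + 1) div 2"
    if j: "j \<ge> 0" and lo: "- j \<le> 3 * m" and hi: "3 * m \<le> j"
  proof -
    have "2 * (j) + 2 * 0 \<le> j * (3 * j + 1) - m * (15 * m + 1)"
    proof (cases "m \<ge> 0")
      case True
      define a where "a = j - 3 * m - 0"
      have a: "a \<ge> 0" "j = 3 * m + a + 0"
        using hi by (auto simp: a_def)
      have "a * m \<ge> 0" "a * a \<ge> a" "m * m \<ge> m"
        using a True sq[of a] sq[of m] by auto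
      thus ?thesis
        using a(1) True unfolding a(2) by (simp only: algebra_simps)
    next
      case False
      define n where "n = - m"
      define a where "a = j - 3 * n + 0"
      have a: "a \<ge> 0" "j = 3 * n + a - 0" and n: "n \<ge> 1" "m = - n"
        using lo False by (auto simp: a_def n_def)
      have "a * n \<ge> a" "a * a \<ge> a" "n * n \<ge> 3 * n - 2"
        using a n sq[of a] sq[of "n - 1"] mult_left_mono[of 1 n a] by (auto simp: algebra_simps)
      thus ?thesis
        using a(1) n(1) unfolding a(2) n(2) by (simp only: algebra_simps)
    qed
    from exponent_lower_bound[OF this] show ?thesis by simp
  qed
  show "j - 1 \<le> j * (3 * j + 1) div 2 - m * (15 * m + 11) div 2 - 1"
    if j: "j \<ge> 1" and lo: "- j - 1 \<le> 3 * m" and hi: "3 * m \<le> j - 1"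
  proof -
    have "2 * (j - 1) + 2 * 1 \<le> j * (3 * j + 1) - m * (15 * m + 11)"
    proof (cases "m \<ge> 0")
      case True
      define a where "a = j - 3 * m - 1"
      have a: "a \<ge> 0" "j = 3 * m + a + 1"
        using hi by (auto simp: a_def)
      have "a * m \<ge> 0" "a * a \<ge> a" "m * m \<ge> m"
        using a True sq[of a] sq[of m] by auto
      thus ?thesis
        using a(1) True unfolding a(2) by (simp only: algebra_simps)
    next
      case False
      define n where "n = - m"
      define a where "a = j - 3 * n + 1"
      have a: "a \<ge> 0" "j = 3 * n + a - 1" and n: "n \<ge> 1" "m = - n"
        using lo False by (auto simp: a_def n_def)
      have "a * n \<ge> a" "a * a \<ge> a" "n * n \<ge> 3 * n - 2"
        using a n sq[of a] sq[of "n - 1"] mult_left_mono[of 1 n a] by (auto simp: algebra_simps)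
      thus ?thesis
        using a(1) n(1) unfolding a(2) n(2) by (simp only: algebra_simps)
    qed
    from exponent_lower_bound[OF this] show ?thesis by simp
  qed
  show "j - 1 \<le> j * (3 * j - 1) div 2 - m * (15 * m + 7) div 2 - 1"
    if j: "j \<ge> 1" and lo: "- j \<le> 3 * m" and hi: "3 * m \<le> j - 1"
  proof -
    have "2 * (j - 1) + 2 * 1 \<le> j * (3 * j + (- 1)) - m * (15 * m + 7)"
    proof (cases "m \<ge> 0")
      case True
      define a where "a = j - 3 * m - 1"
      have a: "a \<ge> 0" "j = 3 * m + a + 1"
        using hi by (auto simp: a_def)
      have "a * m \<ge> 0" "a * a \<ge> a" "m * m \<ge> m"
        using a True sq[of a] sq[of m] by auto
      thus ?thesis
        using a(1) True unfolding a(2) by (simp only: algebra_simps)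
    next
      case False
      define n where "n = - m"
      define a where "a = j - 3 * n + 0"
      have a: "a \<ge> 0" "j = 3 * n + a - 0" and n: "n \<ge> 1" "m = - n"
        using lo False by (auto simp: a_def n_def)
      have "a * n \<ge> a" "a * a \<ge> a" "n * n \<ge> 3 * n - 2"
        using a n sq[of a] sq[of "n - 1"] mult_left_mono[of 1 n a] by (auto simp: algebra_simps)
      thus ?thesis
        using a(1) n(1) unfolding a(2) n(2) by (simp only: algebra_simps)
    qed
    from exponent_lower_bound[OF this] show ?thesis by simp
  qed
  show "j - 1 \<le> j * (3 * j - 1) div 2 - m * (15 * m + 13) div 2 - 2"
    if j: "j \<ge> 1" and lo: "- j - 1 \<le> 3 * m" and hi: "3 * m \<le> j - 2"
  proof -
    have "2 * (j - 1) + 2 * 2 \<le> j * (3 * j + (- 1)) - m * (15 * m + 13)"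
    proof (cases "m \<ge> 0")
      case True
      define a where "a = j - 3 * m - 2"
      have a: "a \<ge> 0" "j = 3 * m + a + 2"
        using hi by (auto simp: a_def)
      have "a * m \<ge> 0" "a * a \<ge> a" "m * m \<ge> m"
        using a True sq[of a] sq[of m] by auto
      thus ?thesis
        using a(1) True unfolding a(2) by (simp only: algebra_simps)
    next
      case False
      define n where "n = - m"
      define a where "a = j - 3 * n + 1"
      have a: "a \<ge> 0" "j = 3 * n + a - 1" and n: "n \<ge> 1" "m = - n"
        using lo False by (auto simp: a_def n_def)
      have "a * n \<ge> a" "a * a \<ge> a" "n * n \<ge> 3 * n - 2"
        using a n sq[of a] sq[of "n - 1"] mult_left_mono[of 1 n a] by (auto simp: algebra_simps)
      thus ?thesis
        using a(1) n(1) unfolding a(2) n(2) by (simp only: algebra_simps)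
    qed
    from exponent_lower_bound[OF this] show ?thesis by simp
  qed
qed

lemma hecke_sums_summable:
  assumes "norm q < 1"
  shows "(\<lambda>j::nat. \<Sum>m | - int j \<le> 3 * m \<and> 3 * m \<le> int j.
            sg m * (- 1) powi (m + int j + 1)
              * q powi (int j * (3 * int j + 1) div 2 - m * (15 * m + 1) div 2)
              * (1 - q ^ (2 * j + 1))) summable_on {0..}"
    and "(\<lambda>j::nat. \<Sum>m | - int j - 1 \<le> 3 * m \<and> 3 * m \<le> int j - 1.
            sg m * (- 1) powi (m + int j + 1)
              * q powi (int j * (3 * int j + 1) div 2 - m * (15 * m + 11) div 2 - 1)
              * (1 - q ^ (2 * j + 1))) summable_on {1..}"
    and "(\<lambda>j::nat. \<Sum>m | - int j \<le> 3 * m \<and> 3 * m \<le> int j - 1.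
            sg m * (- 1) powi (m + int j + 1)
              * q powi (int j * (3 * int j - 1) div 2 - m * (15 * m + 7) div 2 - 1)
              * (1 + q ^ j)) summable_on {1..}"
    and "(\<lambda>j::nat. \<Sum>m | - int j - 1 \<le> 3 * m \<and> 3 * m \<le> int j - 2.
            sg m * (- 1) powi (m + int j + 1)
              * q powi (int j * (3 * int j - 1) div 2 - m * (15 * m + 13) div 2 - 2)
              * (1 + q ^ j)) summable_on {1..}"
proof -
  have 1: "norm (sg m * (- 1) powi k) \<le> 1" for m k :: int
    by (auto simp: sg_def norm_mult norm_power_int)
  have p: "norm (q ^ n) \<le> 1" for n
    using assms by (simp add: norm_power power_le_one)
  have 2: "norm (1 - q ^ n) \<le> 2" "norm (1 + q ^ n) \<le> 2" for n
    using p[of n] norm_triangle_ineq4[of 1 "q ^ n"] norm_triangle_ineq[of 1 "q ^ n"]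
    by (simp_all only: norm_one)
  show "(\<lambda>j::nat. \<Sum>m | - int j \<le> 3 * m \<and> 3 * m \<le> int j.
            sg m * (- 1) powi (m + int j + 1)
              * q powi (int j * (3 * int j + 1) div 2 - m * (15 * m + 1) div 2)
              * (1 - q ^ (2 * j + 1))) summable_on {0..}"
  proof (rule hecke_summable[OF assms _ 1 2(1)], goal_cases)
    case (1 j)
    thus ?case by auto
  next
    case (2 j m)
    thus ?case using exponents_bound(1)[of "int j" m] by auto
  qed
  show "(\<lambda>j::nat. \<Sum>m | - int j - 1 \<le> 3 * m \<and> 3 * m \<le> int j - 1.
            sg m * (- 1) powi (m + int j + 1)
              * q powi (int j * (3 * int j + 1) div 2 - m * (15 * m + 11) div 2 - 1)
              * (1 - q ^ (2 * j + 1))) summable_on {1..}"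
  proof (rule hecke_summable[OF assms _ 1 2(1)], goal_cases)
    case (1 j)
    thus ?case by auto
  next
    case (2 j m)
    thus ?case using exponents_bound(2)[of "int j" m] by auto
  qed
  show "(\<lambda>j::nat. \<Sum>m | - int j \<le> 3 * m \<and> 3 * m \<le> int j - 1.
            sg m * (- 1) powi (m + int j + 1)
              * q powi (int j * (3 * int j - 1) div 2 - m * (15 * m + 7) div 2 - 1)
              * (1 + q ^ j)) summable_on {1..}"
  proof (rule hecke_summable[OF assms _ 1 2(2)], goal_cases)
    case (1 j)
    thus ?case by auto
  next
    case (2 j m)
    thus ?case using exponents_bound(3)[of "int j" m] by auto
  qed
  show "(\<lambda>j::nat. \<Sum>m | - int j - 1 \<le> 3 * m \<and> 3 * m \<le> int j - 2.
            sg m * (- 1) powi (m + int j + 1)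
              * q powi (int j * (3 * int j - 1) div 2 - m * (15 * m + 13) div 2 - 2)
              * (1 + q ^ j)) summable_on {1..}"
  proof (rule hecke_summable[OF assms _ 1 2(2)], goal_cases)
    case (1 j)
    thus ?case by auto
  next
    case (2 j m)
    thus ?case using exponents_bound(4)[of "int j" m] by auto
  qed
qed

end

theory Submission
  imports Defs
begin

text \<open>
  Write \<open>\<chi>\<^sub>0 = \<Sum>\<^sub>n q\<^sup>n (q)\<^sub>n / (q)\<^sub>2\<^sub>n\<close> and \<open>\<chi>\<^sub>1 = \<Sum>\<^sub>n q\<^sup>n (q)\<^sub>n / (q)\<^sub>2\<^sub>n\<^sub>+\<^sub>1\<close>. Bailey
  pairs of Slater's group A expand \<open>1 / (q)\<^sub>2\<^sub>n\<close> and \<open>1 / (q)\<^sub>2\<^sub>n\<^sub>+\<^sub>1\<close> as bilateral sums over \<open>j\<close> of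
  \<open>q\<close> to a pentagonal number divided by a product of two \<open>q\<close>-factorials. After exchanging the sums
  one is left with the conjugate sums \<open>\<Sum>\<^sub>n q\<^sup>n (q)\<^sub>n / ((q)\<^sub>n\<^sub>-\<^sub>r (q)\<^sub>n\<^sub>+\<^sub>r)\<close> and
  \<open>\<Sum>\<^sub>n q\<^sup>n (q)\<^sub>n / ((q)\<^sub>n\<^sub>-\<^sub>r (q)\<^sub>n\<^sub>+\<^sub>r\<^sub>+\<^sub>1)\<close>. Creative telescoping in \<open>n\<close> gives first order recurrences
  in \<open>r\<close> for them, whose unique bounded solutions come from partial theta series; these are the inner sums over
  \<open>j\<close> of the Hecke--Rogers series for fixed \<open>m\<close>.
\<close>

section \<open>Rearranging sums over the integers\<close>

lemma infsum_odd_off_zero: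
  fixes f :: "int \<Rightarrow> complex"
  assumes "f summable_on UNIV" and anti: "\<And>k. k > 0 \<Longrightarrow> f k + f (- k) = 0"
  shows "infsum f UNIV = f 0"
proof -
  have bij: "bij_betw uminus (UNIV :: int set) UNIV"
    by (rule bij_uminus)
  have refl: "(\<lambda>j. f (- j)) summable_on UNIV" "(\<Sum>\<^sub>\<infinity>j. f (- j)) = infsum f UNIV"
    using summable_on_reindex_bij_betw[OF bij, of f] infsum_reindex_bij_betw[OF bij, of f] assms(1)
    by auto
  have "f j + f (- j) = (if j = 0 then 2 * f 0 else 0)" for j
    using anti[of j] anti[of "- j"] by (cases j "0 :: int" rule: linorder_cases) (auto simp: add.commute)
  hence "infsum f UNIV + infsum f UNIV = (\<Sum>\<^sub>\<infinity>j::int. if j = 0 then 2 * f 0 else 0)"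
    using infsum_add[OF assms(1) refl(1)] unfolding refl(2) by simp
  also have "\<dots> = (\<Sum>\<^sub>\<infinity>j::int\<in>{0}. 2 * f 0)"
    by (rule infsum_cong_neutral) auto
  finally show ?thesis by simp
qed

text \<open>\<open>s m\<close> is the least outer index that admits \<open>m\<close>. Writing
  \<open>j = n + s m\<close> straightens the wedge of pairs \<open>(j, m)\<close> into a full
  product, on which summability permits exchanging the two sums.\<close>

lemma infsum_columns:
  fixes f :: "nat \<Rightarrow> int \<Rightarrow> complex" and s :: "int \<Rightarrow> nat"
  assumes summable: "(\<lambda>(n, m). f (n + s m) m) summable_on UNIV \<times> UNIV"
    and A: "\<And>m. {s m..} \<subseteq> A"
    and M: "\<And>j. j \<in> A \<Longrightarrow> finite (M j)" "\<And>j m. j \<in> A \<Longrightarrow> m \<in> M j \<longleftrightarrow> s m \<le> j"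
  shows "(\<Sum>\<^sub>\<infinity>j\<in>A. \<Sum>m\<in>M j. f j m) = (\<Sum>\<^sub>\<infinity>m. \<Sum>\<^sub>\<infinity>n. f (n + s m) m)"
proof -
  have bij: "bij_betw (\<lambda>(n, m). (n + s m, m)) (UNIV \<times> UNIV) (Sigma A M)"
  proof (rule bij_betwI[where g = "\<lambda>(j, m). (j - s m, m)"])
    have "n + s m \<in> A" for n m
      using A[of m] by auto
    thus "(\<lambda>(n, m). (n + s m, m)) \<in> UNIV \<times> UNIV \<rightarrow> Sigma A M"
      using M(2) by auto
  qed (use M(2) in auto)
  have *: "(\<lambda>(j, m). f j m) summable_on Sigma A M"
    using summable_on_reindex_bij_betw[OF bij, of "\<lambda>(j, m). f j m"] summable
    by (simp add: case_prod_unfold)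
  have "(\<Sum>\<^sub>\<infinity>j\<in>A. \<Sum>m\<in>M j. f j m) = (\<Sum>\<^sub>\<infinity>j\<in>A. \<Sum>\<^sub>\<infinity>m\<in>M j. f j m)"
    using M(1) by (intro infsum_cong) simp
  also have "\<dots> = infsum (\<lambda>(j, m). f j m) (Sigma A M)"
    using infsum_Sigma_banach[OF *] by simp
  also have "\<dots> = infsum (\<lambda>(n, m). f (n + s m) m) (UNIV \<times> UNIV)"
    using infsum_reindex_bij_betw[OF bij, of "\<lambda>(j, m). f j m"] by (simp add: case_prod_unfold)
  also have "\<dots> = (\<Sum>\<^sub>\<infinity>n. \<Sum>\<^sub>\<infinity>m. f (n + s m) m)"
    using infsum_Sigma_banach[OF summable] by simp
  also have "\<dots> = (\<Sum>\<^sub>\<infinity>m. \<Sum>\<^sub>\<infinity>n. f (n + s m) m)"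
    by (rule infsum_swap_banach[OF summable])
  finally show ?thesis .
qed

lemma summable_on_diff_complex:
  fixes f g :: "'a \<Rightarrow> complex"
  assumes "f summable_on A" "g summable_on A"
  shows "(\<lambda>x. f x - g x) summable_on A"
  using summable_on_add[OF assms(1), of "\<lambda>x. - g x"] assms(2) by (simp add: summable_on_uminus)

lemma infsum_diff_complex:
  fixes f g :: "'a \<Rightarrow> complex"
  assumes "f summable_on A" "g summable_on A"
  shows "(\<Sum>\<^sub>\<infinity>x\<in>A. f x - g x) = infsum f A - infsum g A"
  using infsum_add[OF assms(1), of "\<lambda>x. - g x"] assms(2) by (simp add: summable_on_uminus infsum_uminus)

text \<open>A bijection preserves the sum of \<open>u\<close>, so the difference contributes
  nothing. This is how the correction terms in the recurrences between the Bailey pairs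
  disappear.\<close>

lemma infsum_add_cancel_reindexed:
  fixes h u :: "int \<Rightarrow> complex"
  assumes "h summable_on UNIV" "u summable_on UNIV" "bij \<sigma>"
  shows "(\<Sum>\<^sub>\<infinity>j. h j + (u j - u (\<sigma> j))) = infsum h UNIV"
proof -
  have s: "(\<lambda>j. u (\<sigma> j)) summable_on UNIV"
    using summable_on_reindex_bij_betw[OF assms(3), of u] assms(2) by simp
  have "(\<Sum>\<^sub>\<infinity>j. h j + (u j - u (\<sigma> j))) = infsum h UNIV + (infsum u UNIV - (\<Sum>\<^sub>\<infinity>j. u (\<sigma> j)))"
    using assms s by (simp add: infsum_add infsum_diff_complex summable_on_diff_complex)
  thus ?thesis
    using infsum_reindex_bij_betw[OF assms(3), of u] by simp
qed

lemma square_ge_abs: "\<bar>j\<bar> \<le> j * j" for j :: int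
  using mult_mono[of 1 "\<bar>j\<bar>" "\<bar>j\<bar>" "\<bar>j\<bar>"] by (cases "j = 0") (auto simp: abs_mult_self_eq)

text \<open>Besides convergence, these bounds give the nonnegativity of the exponents that stand
  under \<open>nat\<close> in \<open>a1\<close> and \<open>a2\<close>.\<close>

lemma abs_le_pentagonal: "\<bar>j\<bar> \<le> j * (6 * j + 1)" "\<bar>j\<bar> \<le> j * (6 * j + 5) + 1" for j :: int
  using square_ge_abs[of j] square_ge_abs[of "j + 1"] by (auto simp: algebra_simps abs_if split: if_splits)

lemma minus_one_powi_eq: "even (x - int n) \<Longrightarrow> (- 1 :: complex) powi x = (- 1) ^ n"
  by (auto simp: power_int_minus_left minus_one_power_iff)

section \<open>Geometric majorants in the unit disc\<close>

locale unit_disc =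
  fixes q :: complex
  assumes norm_q: "norm q < 1"
begin

lemma norm_power_le_1: "norm (q ^ n) \<le> 1"
  using norm_q by (simp add: norm_power power_le_one)

lemma power_neq_1: "n > 0 \<Longrightarrow> 1 - q ^ n \<noteq> 0"
proof
  assume "n > 0" "1 - q ^ n = 0"
  hence "norm q ^ n = 1" by (metis eq_iff_diff_eq_0 norm_one norm_power)
  moreover have "norm q ^ n < 1"
    using norm_q \<open>n > 0\<close> by (subst power_less_one_iff) auto
  ultimately show False by simp
qed

lemma summable_nat_weight: "(\<lambda>n. norm q ^ n) summable_on UNIV"
  using norm_q by (intro norm_summable_imp_summable_on) (simp add: summable_geometric)

lemma summable_int_weight: "(\<lambda>j::int. norm q ^ nat \<bar>j\<bar>) summable_on UNIV"
proof -
  have "(\<lambda>j::int. norm q ^ nat \<bar>j\<bar>) summable_on (range int \<union> range (\<lambda>n. - int n))"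
    by (intro summable_on_union) (simp_all add: summable_on_reindex inj_on_def o_def summable_nat_weight)
  also have "range int \<union> range (\<lambda>n. - int n) = UNIV"
    by (auto simp: image_iff) (metis int_cases2)
  finally show ?thesis .
qed

lemma summable_nat:
  fixes f :: "nat \<Rightarrow> complex"
  assumes "\<And>n. norm (f n) \<le> K * norm q ^ n"
  shows "f summable_on UNIV"
proof (rule abs_summable_summable, rule Infinite_Sum.abs_summable_on_comparison_test)
  show "(\<lambda>n. norm (K * norm q ^ n)) summable_on UNIV"
    by (simp add: abs_mult summable_on_cmult_right summable_nat_weight)
  show "norm (f n) \<le> norm (K * norm q ^ n)" for n
    using assms[of n] by simp
qed

lemma summable_int:
  fixes f :: "int \<Rightarrow> complex"
  assumes "\<And>j. norm (f j) \<le> K * norm q ^ nat \<bar>j\<bar>"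
  shows "f summable_on UNIV"
proof (rule abs_summable_summable, rule Infinite_Sum.abs_summable_on_comparison_test)
  show "(\<lambda>j::int. norm (K * norm q ^ nat \<bar>j\<bar>)) summable_on UNIV"
    by (simp add: abs_mult summable_on_cmult_right summable_int_weight)
  show "norm (f j) \<le> norm (K * norm q ^ nat \<bar>j\<bar>)" for j
    using assms[of j] by simp
qed

lemma summable_nat_int:
  fixes f :: "nat \<Rightarrow> int \<Rightarrow> complex"
  assumes "\<And>n j. norm (f n j) \<le> K * (norm q ^ n * norm q ^ nat \<bar>j\<bar>)"
  shows "(\<lambda>(n, j). f n j) summable_on UNIV \<times> UNIV"
proof (rule abs_summable_summable, rule Infinite_Sum.abs_summable_on_comparison_test)
  have "(\<lambda>(n, j::int). norm q ^ n * norm q ^ nat \<bar>j\<bar>) summable_on UNIV \<times> UNIV"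
  proof (rule summable_on_SigmaI)
    show "((\<lambda>j::int. case (n, j) of (n, j) \<Rightarrow> norm q ^ n * norm q ^ nat \<bar>j\<bar>)
            has_sum norm q ^ n * (\<Sum>\<^sub>\<infinity>j::int. norm q ^ nat \<bar>j\<bar>)) UNIV" for n
      by (simp add: has_sum_cmult_right summable_int_weight)
    show "(\<lambda>n. norm q ^ n * (\<Sum>\<^sub>\<infinity>j::int. norm q ^ nat \<bar>j\<bar>)) summable_on UNIV"
      by (intro summable_on_cmult_left summable_nat_weight)
  qed auto
  thus "(\<lambda>x. norm (case x of (n, j::int) \<Rightarrow> K * (norm q ^ n * norm q ^ nat \<bar>j\<bar>))) summable_on UNIV \<times> UNIV"
    by (simp add: case_prod_unfold abs_mult summable_on_cmult_right)
  show "norm (case x of (n, j) \<Rightarrow> f n j)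
          \<le> norm (case x of (n, j) \<Rightarrow> K * (norm q ^ n * norm q ^ nat \<bar>j\<bar>))" for x
    using assms[of "fst x" "snd x"] by (simp add: case_prod_unfold)
qed

section \<open>The \<open>q\<close>-factorials and their reciprocals\<close>

definition qf :: "nat \<Rightarrow> complex" where
  "qf n = qpoch q q n"

text \<open>The value 0 at negative arguments is what \<open>1 / (q)\<^sub>k\<close> has to be for \<open>rq_step\<close> to hold
  for all integers.\<close>

definition rq :: "int \<Rightarrow> complex" where
  "rq k = (if k < 0 then 0 else 1 / qf (nat k))"

abbreviation P :: complex where
  "P \<equiv> qpoch_inf q"

lemma qf_0 [simp]: "qf 0 = 1"
  by (simp add: qf_def qpoch_def)

lemma qf_Suc: "qf (Suc n) = qf n * (1 - q ^ Suc n)"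
  by (simp add: qf_def qpoch_def)

lemma qf_nonzero [simp]: "qf n \<noteq> 0"
  using qpoch_nonzero[OF norm_q, of 0 n] by (simp add: qf_def)

lemma qf_tendsto: "qf \<longlonglongrightarrow> P"
  using has_prod_imp_tendsto'[OF qpoch_inf_has_prod[OF norm_q]]
  by (simp add: qf_def[abs_def] qpoch_def)

lemma P_nonzero: "P \<noteq> 0"
  using has_prod_eq_0_iff[OF qpoch_inf_has_prod[OF norm_q]] power_neq_1[OF zero_less_Suc]
  by (auto simp del: power_Suc)

lemma rq_neg [simp]: "k < 0 \<Longrightarrow> rq k = 0"
  by (simp add: rq_def)

lemma rq_0 [simp]: "rq 0 = 1"
  by (simp add: rq_def)

text \<open>For \<open>k \<le> 0\<close> the factor is \<open>1 - q ^ 0 = 0\<close>, in agreement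
  with the value 0 of \<open>rq (k - 1)\<close>.\<close>

lemma rq_step: "rq (k - 1) = (1 - q ^ nat k) * rq k"
proof (cases "k > 0")
  case True
  then obtain n where "k = int (Suc n)"
    by (metis pos_int_cases of_nat_Suc Suc_pred)
  hence "nat k = Suc n" "nat (k - 1) = n" "k > 0" by auto
  thus ?thesis
    using power_neq_1[of "Suc n"] by (simp add: rq_def qf_Suc del: power_Suc)
next
  case False
  thus ?thesis by (cases "k = 0") auto
qed

lemma rq_tendsto: "(\<lambda>n. rq (int n + c)) \<longlonglongrightarrow> 1 / P"
proof -
  have "(\<lambda>n. rq (int n)) \<longlonglongrightarrow> 1 / P"
    using tendsto_divide[OF tendsto_const qf_tendsto P_nonzero, of 1] by (simp add: rq_def)
  hence "(\<lambda>n. rq (int (n + nat c))) \<longlonglongrightarrow> 1 / P"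
    by (rule LIMSEQ_ignore_initial_segment)
  moreover have shift: "int (n + nat (- c)) + c = int (n + nat c)" for n
    by simp
  ultimately have "(\<lambda>n. rq (int (n + nat (- c)) + c)) \<longlonglongrightarrow> 1 / P"
    by (simp only: shift)
  thus ?thesis by (rule LIMSEQ_offset)
qed

text \<open>\<open>qf\<close> and its reciprocals converge, since \<open>P\<close> is nonzero, and
  so are bounded. The bound is uniform in all three indices: multiplied by
  \<open>norm q ^ n\<close>, it dominates the conjugate sums for every \<open>r\<close> at
  once.\<close>

lemma bounded_products: "\<exists>K. \<forall>n a b. norm (qf n * rq a * rq b) \<le> K"
proof -
  obtain A where A: "\<And>n. norm (qf n) \<le> A"
    using convergent_imp_Bseq[of qf] qf_tendsto by (auto simp: convergent_def Bseq_def)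
  have "Bseq (\<lambda>n. rq (int n))"
    using rq_tendsto[of 0] by (intro convergent_imp_Bseq) (auto simp: convergent_def)
  then obtain B where B: "B > 0" "\<And>n. norm (rq (int n)) \<le> B"
    by (auto simp: Bseq_def)
  have B': "norm (rq k) \<le> B" for k
    using B(1) B(2)[of "nat k"] by (cases "k < 0") auto
  have "norm (qf n * rq a * rq b) \<le> A * B * B" for n a b
    unfolding norm_mult using A B(1) B' norm_ge_zero[of "qf n"] order_trans[OF norm_ge_zero A]
    by (intro mult_mono mult_nonneg_nonneg) auto
  thus ?thesis by blast
qed

definition K :: real where
  "K = (SOME K. \<forall>n a b. norm (qf n * rq a * rq b) \<le> K)"

lemma product_bound: "norm (qf n * rq a * rq b) \<le> K"
  using someI_ex[OF bounded_products] by (auto simp: K_def)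

lemma weighted_product_bound: "norm (q ^ n * qf n * rq a * rq b) \<le> K * norm q ^ n"
proof -
  have "norm (q ^ n * qf n * rq a * rq b) = norm (qf n * rq a * rq b) * norm q ^ n"
    by (simp add: norm_mult norm_power)
  thus ?thesis using product_bound by (simp add: mult_right_mono)
qed

lemma rq_products_bounded: "norm (rq a * rq b) \<le> K"
  using product_bound[of 0 a b] by simp

text \<open>The exponents are the generalized pentagonal numbers \<open>k * (3 * k - 1) / 2\<close>,
  at the even indices \<open>k = - 2 * j\<close> for \<open>a1\<close> and at the odd indices
  \<open>k = 2 * j + 1\<close> for \<open>a2\<close>.\<close>

definition a1 :: "int \<Rightarrow> complex" where
  "a1 j = q ^ nat (j * (6 * j + 1))"

definition a2 :: "int \<Rightarrow> complex" where
  "a2 j = q ^ nat (j * (6 * j + 5) + 1)"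

lemma a_bounds: "norm (a1 j) \<le> norm q ^ nat \<bar>j\<bar>" "norm (a2 j) \<le> norm q ^ nat \<bar>j\<bar>"
  unfolding a1_def a2_def norm_power using norm_q abs_le_pentagonal[of j]
  by (auto intro!: power_decreasing nat_mono)

lemma a_summable:
  assumes "\<And>j. norm (f j) \<le> C"
  shows "(\<lambda>j. a1 j * f j) summable_on UNIV" "(\<lambda>j. a2 j * f j) summable_on UNIV"
proof -
  have "norm (a1 j * f j) \<le> C * norm q ^ nat \<bar>j\<bar>" "norm (a2 j * f j) \<le> C * norm q ^ nat \<bar>j\<bar>" for j
    using mult_mono[OF a_bounds(1) assms[of j]] mult_mono[OF a_bounds(2) assms[of j]]
    by (simp_all add: norm_mult mult.commute)
  thus "(\<lambda>j. a1 j * f j) summable_on UNIV" "(\<lambda>j. a2 j * f j) summable_on UNIV"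
    by (auto intro!: summable_int)
qed

lemma power_nat_add: "0 \<le> a \<Longrightarrow> 0 \<le> b \<Longrightarrow> q ^ nat a * q ^ nat b = q ^ nat (a + b)"
  by (simp add: nat_add_distrib power_add)

text \<open>This is \<open>1 - q ^ (a + b) = (1 - q ^ b) + q ^ b * (1 - q ^ a)\<close> combined with
  \<open>rq_step\<close>. If \<open>a\<close> or \<open>b\<close> is negative, both sides vanish, so
  the truncation by \<open>nat\<close> does no harm.\<close>

lemma rq_Pascal:
  "(1 - q ^ nat (a + b)) * (rq a * rq b) = rq a * rq (b - 1) + q ^ nat b * (rq (a - 1) * rq b)"
proof (cases "a < 0 \<or> b < 0")
  case False
  hence "q ^ nat (a + b) = q ^ nat a * q ^ nat b"
    by (simp add: power_nat_add)
  thus ?thesis by (simp add: rq_step algebra_simps)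
qed auto

subsection \<open>The Bailey pairs\<close>

text \<open>Terms of Bailey pairs in bilateral form, relative to 1 here and, up to a factor
  \<open>1 - q\<close>, relative to \<open>q\<close> in \<open>bailey_odd\<close>: the weight of the
  index \<open>r\<close> is \<open>a1 j\<close> at \<open>r = 3 * j\<close>, \<open>- a2 j\<close>
  at \<open>r = 3 * j + 1\<close> and 0 at \<open>r = 3 * j + 2\<close>.\<close>

definition bailey_even :: "nat \<Rightarrow> int \<Rightarrow> complex" where
  "bailey_even n j = a1 j * (rq (int n - 3 * j) * rq (int n + 3 * j))
     - a2 j * (rq (int n - 3 * j - 1) * rq (int n + 3 * j + 1))"

definition bailey_odd :: "nat \<Rightarrow> int \<Rightarrow> complex" where
  "bailey_odd n j = a1 j * (rq (int n - 3 * j) * rq (int n + 3 * j + 1))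
     - a2 j * (rq (int n - 3 * j - 1) * rq (int n + 3 * j + 2))"

lemma bailey_summable: "bailey_even n summable_on UNIV" "bailey_odd n summable_on UNIV"
  unfolding bailey_even_def[abs_def] bailey_odd_def[abs_def]
  by (rule summable_on_diff_complex; rule a_summable[where C = K]; rule rq_products_bounded)+

lemma bounded_correction: "norm (q ^ k * (rq a * rq b)) \<le> K"
proof -
  have "norm (q ^ k) * norm (rq a * rq b) \<le> 1 * K"
    by (intro mult_mono norm_power_le_1 rq_products_bounded) auto
  thus ?thesis by (simp add: norm_mult)
qed

text \<open>The correction terms of the \<open>q\<close>-Pascal rule cancel under \<open>j \<mapsto> - 1 - j\<close> in the first of
  the following two steps and under \<open>j \<mapsto> - j\<close> in the second.\<close>

lemma bailey_odd_step:
  "(1 - q ^ (2 * n + 1)) * infsum (bailey_odd n) UNIV = infsum (bailey_even n) UNIV"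
proof -
  define u where
    "u j = a1 j * (q ^ nat (int n + 3 * j + 1) * (rq (int n - 3 * j - 1) * rq (int n + 3 * j + 1)))" for j
  have u: "u summable_on UNIV"
    unfolding u_def[abs_def] by (rule a_summable(1)[where C = K], rule bounded_correction)
  have reflect: "a2 j * (q ^ nat (int n + 3 * j + 2) * (rq (int n - 3 * j - 2) * rq (int n + 3 * j + 2)))
                   = u (- 1 - j)" for j
  \<comment> \<open>The powers can be merged only when their exponents are nonnegative; otherwise a
    factor \<open>rq\<close> vanishes on both sides.\<close>
  proof (cases "0 \<le> int n - 3 * j - 2 \<and> 0 \<le> int n + 3 * j + 2")
    case True
    moreover have "0 \<le> j * (6 * j + 5) + 1" "0 \<le> (- 1 - j) * (6 * (- 1 - j) + 1)"
      using abs_le_pentagonal(2)[of j] abs_le_pentagonal(1)[of "- 1 - j"] by linarith+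
    ultimately have "a2 j * q ^ nat (int n + 3 * j + 2)
        = q ^ nat (j * (6 * j + 5) + 1 + (int n + 3 * j + 2))"
      "a1 (- 1 - j) * q ^ nat (int n - 3 * j - 2)
        = q ^ nat ((- 1 - j) * (6 * (- 1 - j) + 1) + (int n - 3 * j - 2))"
      unfolding a1_def a2_def by - (rule power_nat_add; linarith)+
    moreover have "j * (6 * j + 5) + 1 + (int n + 3 * j + 2)
        = (- 1 - j) * (6 * (- 1 - j) + 1) + (int n - 3 * j - 2)"
      by (simp add: algebra_simps)
    ultimately have "a2 j * q ^ nat (int n + 3 * j + 2) = a1 (- 1 - j) * q ^ nat (int n - 3 * j - 2)"
      by simp
    moreover have "int n + 3 * (- 1 - j) + 1 = int n - 3 * j - 2"
        "int n - 3 * (- 1 - j) - 1 = int n + 3 * j + 2"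
      by simp_all
    ultimately show ?thesis
      unfolding u_def mult.assoc[symmetric] by (simp only: mult.assoc mult.left_commute mult.commute)
  next
    case False
    thus ?thesis by (auto simp: u_def)
  qed
  have "(1 - q ^ (2 * n + 1)) * bailey_odd n j = bailey_even n j + (u j - u (- 1 - j))" for j
  proof -
    have "(1 - q ^ (2 * n + 1)) * bailey_odd n j
        = a1 j * ((1 - q ^ nat ((int n - 3 * j) + (int n + 3 * j + 1))) * (rq (int n - 3 * j) * rq (int n + 3 * j + 1)))
        - a2 j * ((1 - q ^ nat ((int n - 3 * j - 1) + (int n + 3 * j + 2)))
                    * (rq (int n - 3 * j - 1) * rq (int n + 3 * j + 2)))"
      by (simp add: bailey_odd_def algebra_simps nat_add_distrib nat_mult_distrib)
    thus ?thesis
      unfolding rq_Pascal reflect[symmetric] unfolding bailey_even_def u_def by (simp add: algebra_simps)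
  qed
  hence "(\<Sum>\<^sub>\<infinity>j. (1 - q ^ (2 * n + 1)) * bailey_odd n j) = infsum (bailey_even n) UNIV"
    using infsum_add_cancel_reindexed[OF bailey_summable(1) u, of "\<lambda>j. - 1 - j"]
    by (simp add: bij_def inj_def surj_def)
  thus ?thesis
    by (subst (asm) infsum_cmult_right) (use bailey_summable in auto)
qed

lemma bailey_even_step:
  "(1 - q ^ (2 * n + 2)) * infsum (bailey_even (Suc n)) UNIV = infsum (bailey_odd n) UNIV"
proof -
  define u where
    "u j = a1 j * (q ^ nat (int n - 3 * j + 1) * (rq (int n + 3 * j) * rq (int n - 3 * j + 1)))" for j
  have u: "u summable_on UNIV"
    unfolding u_def[abs_def] by (rule a_summable(1)[where C = K], rule bounded_correction)
  have reflect: "a2 j * (q ^ nat (int n - 3 * j) * (rq (int n + 3 * j + 1) * rq (int n - 3 * j)))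
                   = u (- j)" for j
  proof (cases "0 \<le> int n - 3 * j \<and> 0 \<le> int n + 3 * j + 1")
    case True
    moreover have "0 \<le> j * (6 * j + 5) + 1" "0 \<le> (- j) * (6 * (- j) + 1)"
      using abs_le_pentagonal(2)[of j] abs_le_pentagonal(1)[of "- j"] by linarith+
    ultimately have "a2 j * q ^ nat (int n - 3 * j)
        = q ^ nat (j * (6 * j + 5) + 1 + (int n - 3 * j))"
      "a1 (- j) * q ^ nat (int n + 3 * j + 1)
        = q ^ nat ((- j) * (6 * (- j) + 1) + (int n + 3 * j + 1))"
      unfolding a1_def a2_def by - (rule power_nat_add; linarith)+
    moreover have "j * (6 * j + 5) + 1 + (int n - 3 * j)
        = (- j) * (6 * (- j) + 1) + (int n + 3 * j + 1)"
      by (simp add: algebra_simps)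
    ultimately have "a2 j * q ^ nat (int n - 3 * j) = a1 (- j) * q ^ nat (int n + 3 * j + 1)"
      by simp
    moreover have "int n - 3 * (- j) + 1 = int n + 3 * j + 1" "int n + 3 * (- j) = int n - 3 * j"
      by simp_all
    ultimately show ?thesis
      unfolding u_def mult.assoc[symmetric] by (simp only: mult.assoc mult.left_commute mult.commute)
  next
    case False
    thus ?thesis by (auto simp: u_def)
  qed
  have "(1 - q ^ (2 * n + 2)) * bailey_even (Suc n) j = bailey_odd n j + (u j - u (- j))" for j
  proof -
    \<comment> \<open>The factor with \<open>+ 3 * j\<close> is put first, so that the main term of
      \<open>rq_Pascal\<close> lowers the other one, as \<open>bailey_odd n\<close>
      requires.\<close>
    have "(1 - q ^ (2 * n + 2)) * bailey_even (Suc n) j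
        = a1 j * ((1 - q ^ nat ((int n + 3 * j + 1) + (int n - 3 * j + 1))) * (rq (int n + 3 * j + 1) * rq (int n - 3 * j + 1)))
        - a2 j * ((1 - q ^ nat ((int n + 3 * j + 2) + (int n - 3 * j)))
                    * (rq (int n + 3 * j + 2) * rq (int n - 3 * j)))"
      by (simp add: bailey_even_def algebra_simps nat_add_distrib nat_mult_distrib)
    thus ?thesis
      unfolding rq_Pascal reflect[symmetric] unfolding bailey_odd_def u_def by (simp add: algebra_simps)
  qed
  hence "(\<Sum>\<^sub>\<infinity>j. (1 - q ^ (2 * n + 2)) * bailey_even (Suc n) j) = infsum (bailey_odd n) UNIV"
    using infsum_add_cancel_reindexed[OF bailey_summable(2) u, of "\<lambda>j. - j"]
    by (simp add: bij_uminus)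
  thus ?thesis
    by (subst (asm) infsum_cmult_right) (use bailey_summable in auto)
qed

text \<open>The two steps chain into one induction, from even to odd at \<open>n\<close> and from
  odd at \<open>n\<close> to even at \<open>Suc n\<close>, each dividing by the next factor of the
  \<open>q\<close>-factorial. At \<open>n = 0\<close> only \<open>j = 0\<close> contributes.\<close>

lemma bailey_even_odd:
  "infsum (bailey_even n) UNIV = rq (2 * int n) \<and> infsum (bailey_odd n) UNIV = rq (2 * int n + 1)"
proof -
  have odd: "infsum (bailey_odd n) UNIV = rq (2 * int n + 1)"
    if "infsum (bailey_even n) UNIV = rq (2 * int n)" for n
  proof -
    have "nat (2 * int n + 1) = 2 * n + 1" by simp
    thus ?thesis
      using that bailey_odd_step[of n] rq_step[of "2 * int n + 1"] power_neq_1[of "2 * n + 1"]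
      by simp
  qed
  have "infsum (bailey_even n) UNIV = rq (2 * int n)"
  proof (induction n)
    case 0
    have "infsum (bailey_even 0) UNIV = infsum (bailey_even 0) {0}"
    proof (rule infsum_cong_neutral)
      fix j :: int
      assume "j \<in> UNIV - {0}"
      hence "- 3 * j < 0 \<or> 3 * j < 0" "- 3 * j - 1 < 0 \<or> 3 * j + 1 < 0"
        by auto
      thus "bailey_even 0 j = 0"
        by (auto simp: bailey_even_def)
    qed auto
    also have "\<dots> = 1"
      by (simp add: bailey_even_def a1_def)
    finally show ?case by simp
  next
    case (Suc n)
    have "nat (2 * int (Suc n)) = 2 * n + 2" "2 * int (Suc n) - 1 = 2 * int n + 1" by simp_all
    thus ?case
      using odd[OF Suc] bailey_even_step[of n] rq_step[of "2 * int (Suc n)"] power_neq_1[of "2 * n + 2"]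
      by (simp add: add.commute)
  qed
  with odd show ?thesis by blast
qed

subsection \<open>Partial theta series and the conjugate sums\<close>

text \<open>For odd \<open>c\<close> this is the tail over \<open>j = r + n\<close> of the series
  with terms \<open>(- 1) ^ j * q ^ (j * (3 * j + c) div 2) * h j\<close>, with the sign and power
  of its leading term divided out. The form avoids negative powers and includes
  \<open>q = 0\<close>.\<close>

definition partial_theta :: "nat \<Rightarrow> (nat \<Rightarrow> complex) \<Rightarrow> nat \<Rightarrow> complex" where
  "partial_theta c h r = (\<Sum>\<^sub>\<infinity>n. (- 1) ^ n * q ^ (3 * r * n + n * (3 * n + c) div 2) * h (r + n))"

lemma partial_theta_bound:
  assumes "c > 0" "\<And>n. norm (h n) \<le> 2"
  shows "norm ((- 1) ^ n * q ^ (3 * r * n + n * (3 * n + c) div 2) * h (r + n)) \<le> 2 * norm q ^ n"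
proof -
  have "n * 2 \<le> n * (3 * n + c)"
    using assms(1) by (cases n) (auto intro!: mult_left_mono)
  hence "n \<le> 3 * r * n + n * (3 * n + c) div 2"
    by linarith
  hence "norm q ^ (3 * r * n + n * (3 * n + c) div 2) \<le> norm q ^ n"
    using norm_q by (intro power_decreasing) auto
  hence "norm q ^ (3 * r * n + n * (3 * n + c) div 2) * norm (h (r + n)) \<le> norm q ^ n * 2"
    using assms(2) by (intro mult_mono) auto
  thus ?thesis by (simp add: norm_mult norm_power)
qed

lemma infsum_nat_Suc:
  fixes f :: "nat \<Rightarrow> complex"
  assumes "\<And>n. norm (f n) \<le> B * norm q ^ n"
  shows "infsum f UNIV = f 0 + (\<Sum>\<^sub>\<infinity>n. f (Suc n))"
proof -
  have "norm (f (Suc n)) \<le> B * norm q * norm q ^ n" for n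
    using assms[of "Suc n"] by (simp add: mult.assoc)
  hence "(\<lambda>n. f (Suc n)) summable_on UNIV"
    by (rule summable_nat)
  hence "(\<lambda>n. f (Suc n)) sums (\<Sum>\<^sub>\<infinity>n. f (Suc n))"
    by (intro has_sum_imp_sums has_sum_infsum)
  hence "f sums ((\<Sum>\<^sub>\<infinity>n. f (Suc n)) + f 0)"
    by (subst (asm) sums_Suc_iff) simp
  moreover have "f sums infsum f UNIV"
    using summable_nat[OF assms] by (intro has_sum_imp_sums has_sum_infsum)
  ultimately have "infsum f UNIV = (\<Sum>\<^sub>\<infinity>n. f (Suc n)) + f 0"
    using sums_unique2 by blast
  thus ?thesis by simp
qed

lemma norm_infsum_nat_le:
  fixes f :: "nat \<Rightarrow> complex"
  assumes "\<And>n. norm (f n) \<le> B * norm q ^ n"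
  shows "norm (infsum f UNIV) \<le> B * (\<Sum>\<^sub>\<infinity>n. norm q ^ n)"
  using summable_nat[OF assms]
  by (rule norm_infsum_le[OF has_sum_infsum has_sum_cmult_right[OF has_sum_infsum[OF summable_nat_weight]] assms])

text \<open>Split off the term \<open>n = 0\<close>. The term \<open>Suc n\<close> at
  \<open>r\<close> is a fixed multiple of the term \<open>n\<close> at \<open>Suc r\<close>; oddness
  of \<open>c\<close> makes all halved exponents exact.\<close>

lemma partial_theta_rec:
  assumes "odd c" "\<And>n. norm (h n) \<le> 2"
  shows "partial_theta c h r = h r - q ^ (3 * r + (3 + c) div 2) * partial_theta c h (Suc r)"
proof -
  define t where "t r n = (- 1) ^ n * q ^ (3 * r * n + n * (3 * n + c) div 2) * h (r + n)" for r n
  have t: "norm (t r n) \<le> 2 * norm q ^ n" for r n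
    unfolding t_def using assms by (intro partial_theta_bound) (auto intro: odd_pos)
  have "t r (Suc n) = - (q ^ (3 * r + (3 + c) div 2)) * t (Suc r) n" for n
  proof -
    obtain u where u: "n * (3 * n + c) = 2 * u"
      using assms(1) by (metis dvdE even_add even_mult_iff odd_numeral)
    obtain v where v: "3 + c = 2 * v"
      using assms(1) by (metis dvdE even_add odd_numeral)
    have "Suc n * (3 * Suc n + c) = 2 * (u + v + 3 * n)"
      using u v by (simp add: algebra_simps)
    hence "3 * r * Suc n + Suc n * (3 * Suc n + c) div 2
        = (3 * r + (3 + c) div 2) + (3 * Suc r * n + n * (3 * n + c) div 2)"
      unfolding u v by (simp add: algebra_simps)
    hence "q ^ (3 * r * Suc n + Suc n * (3 * Suc n + c) div 2)
        = q ^ (3 * r + (3 + c) div 2) * q ^ (3 * Suc r * n + n * (3 * n + c) div 2)"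
      by (simp only: power_add)
    thus ?thesis
      by (simp only: t_def) simp
  qed
  moreover have t0: "t r 0 = h r"
    by (simp add: t_def)
  ultimately have "(\<Sum>\<^sub>\<infinity>n. t r (Suc n)) = - (q ^ (3 * r + (3 + c) div 2)) * infsum (t (Suc r)) UNIV"
    using infsum_cmult_right[OF summable_nat[OF t[of "Suc r"]], of "- (q ^ (3 * r + (3 + c) div 2))"]
    by simp
  moreover have "partial_theta c h r = infsum (t r) UNIV" for r
    unfolding partial_theta_def t_def ..
  ultimately show ?thesis
    using infsum_nat_Suc[OF t[of r]] t0 by simp
qed

text \<open>The difference of two solutions satisfies the homogeneous recurrence, so
  \<open>k\<close> iterations bound it by \<open>norm q ^ k\<close> times a constant, which tends to
  0. The start \<open>r0\<close> allows for solutions that make sense only from \<open>r = 1\<close>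
  on.\<close>

lemma recurrence_unique:
  fixes X Y u v :: "nat \<Rightarrow> complex"
  assumes X: "\<And>r. r \<ge> r0 \<Longrightarrow> X r = u r - v r * X (Suc r)"
    and Y: "\<And>r. r \<ge> r0 \<Longrightarrow> Y r = u r - v r * Y (Suc r)"
    and v: "\<And>r. r \<ge> r0 \<Longrightarrow> norm (v r) \<le> norm q"
    and B: "\<And>r. r \<ge> r0 \<Longrightarrow> norm (X r) \<le> A" "\<And>r. r \<ge> r0 \<Longrightarrow> norm (Y r) \<le> B"
    and "r \<ge> r0"
  shows "X r = Y r"
proof -
  have le: "norm (X r - Y r) \<le> norm q ^ k * (A + B)" if "r \<ge> r0" for k r
    using that
  proof (induction k arbitrary: r)
    case 0
    thus ?case using B[of r] norm_triangle_ineq4[of "X r" "Y r"] by simp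
  next
    case (Suc k)
    have "X r - Y r = - (v r * (X (Suc r) - Y (Suc r)))"
      using X[of r] Y[of r] Suc.prems by (simp add: algebra_simps)
    hence "norm (X r - Y r) = norm (v r) * norm (X (Suc r) - Y (Suc r))"
      by (simp only: norm_minus_cancel norm_mult)
    also have "\<dots> \<le> norm q * (norm q ^ k * (A + B))"
      using Suc.IH[of "Suc r"] Suc.prems v[of r] by (intro mult_mono) auto
    finally show ?case by simp
  qed
  have "(\<lambda>k. norm q ^ k * (A + B)) \<longlonglongrightarrow> 0 * (A + B)"
    using norm_q by (intro tendsto_mult LIMSEQ_realpow_zero tendsto_const) auto
  hence "norm (X r - Y r) \<le> 0 * (A + B)"
    using le[OF \<open>r \<ge> r0\<close>] by (intro LIMSEQ_le_const) auto
  thus ?thesis by simp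
qed

text \<open>Conjugate Bailey sums for the sequence \<open>q ^ n * qf n\<close>, relative to 1 for
  \<open>R\<close> and to \<open>q\<close> for \<open>S\<close>. The factor \<open>P\<close> cancels
  the \<open>1 / P\<close> that telescoping leaves as a limit.\<close>

definition R :: "int \<Rightarrow> complex" where
  "R r = P * (\<Sum>\<^sub>\<infinity>n. q ^ n * qf n * rq (int n - r) * rq (int n + r))"

definition S :: "int \<Rightarrow> complex" where
  "S r = P * (\<Sum>\<^sub>\<infinity>n. q ^ n * qf n * rq (int n - r) * rq (int n + r + 1))"

lemma R_minus: "R (- r) = R r"
  by (simp add: R_def mult_ac)

lemma S_reflect: "S (- 1 - r) = S r"
proof -
  have "int n - (- 1 - r) = int n + r + 1" "int n + (- 1 - r) + 1 = int n - r" for n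
    by simp_all
  thus ?thesis
    unfolding S_def by (simp only: mult.assoc mult.commute[of "rq (_ - r)"])
qed

lemma R_S_bounded: "norm (R r) \<le> norm P * (K * (\<Sum>\<^sub>\<infinity>n. norm q ^ n))"
    "norm (S r) \<le> norm P * (K * (\<Sum>\<^sub>\<infinity>n. norm q ^ n))"
  unfolding R_def S_def norm_mult by (intro mult_left_mono norm_infsum_nat_le weighted_product_bound norm_ge_zero)+

lemma R_S_sums:
  "(\<lambda>n. q ^ n * qf n * rq (int n - r) * rq (int n + r)) sums (R r / P)"
  "(\<lambda>n. q ^ n * qf n * rq (int n - r) * rq (int n + r + 1)) sums (S r / P)"
  using P_nonzero has_sum_imp_sums[OF has_sum_infsum[OF summable_nat[OF weighted_product_bound]]]
  by (simp_all add: R_def S_def)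

lemma telescope_limit:
  "(\<lambda>n. c * (qf n * rq (int n + a) * rq (int n + b))) \<longlonglongrightarrow> c / P"
proof -
  have "(\<lambda>n. c * (qf n * rq (int n + a) * rq (int n + b))) \<longlonglongrightarrow> c * (P * (1 / P) * (1 / P))"
    by (intro tendsto_intros qf_tendsto rq_tendsto)
  thus ?thesis using P_nonzero by simp
qed

text \<open>A combination of the summands at \<open>r\<close> and \<open>Suc r\<close> is the
  forward difference of \<open>g\<close>, which starts at 0 and tends to
  \<open>c / P\<close>.\<close>

lemma S_rec: "S (int r) = q ^ r * (1 + q ^ (r + 1)) - q ^ (3 * r + 3) * S (int (Suc r))"
proof -
  define c where "c = q ^ r * (1 + q ^ (r + 1))"
  \<comment> \<open>telescoping certificate, from the ansatz of a constant times this product\<close>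
  define g where "g n = c * (qf n * rq (int n + (- int r - 1)) * rq (int n + (int r + 1)))" for n
  have "q ^ n * qf n * rq (int n - int r) * rq (int n + int r + 1)
      + q ^ (3 * r + 3) * (q ^ n * qf n * rq (int n - int (Suc r)) * rq (int n + int (Suc r) + 1))
      = g (Suc n) - g n" for n
  proof (cases "n < r")
    case True
    thus ?thesis by (simp add: g_def)
  next
    case False
    then obtain d where n: "n = r + d"
      using le_Suc_ex by (metis not_less)
    \<comment> \<open>In terms of \<open>x\<close>, \<open>y\<close>, \<open>q\<close> and the
      reciprocal factorials \<open>z\<close> and \<open>rq (int d)\<close>, the claim becomes a
      polynomial identity.\<close>
    define x y where "x = q ^ r" and "y = q ^ d"
    define z where "z = rq (int (2 * r + d + 2))"
    have 1: "rq (int n - int r) = rq (int d)" "rq (int n - int (Suc r)) = (1 - y) * rq (int d)"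
      using rq_step[of "int d"] by (simp_all add: n y_def)
    have "nat (int (2 * r + d + 2)) = r + r + d + 2" by simp
    hence 2: "rq (int n + int (Suc r) + 1) = z" "rq (int n + int r + 1) = (1 - x * x * y * q ^ 2) * z"
      using rq_step[of "int (2 * r + d + 2)"]
      by (simp_all add: n z_def x_def y_def power_add power2_eq_square algebra_simps del: nat_int)
    have 3: "rq (int n + (- int r - 1)) = (1 - y) * rq (int d)" "rq (int n + (int r + 1)) = (1 - x * x * y * q ^ 2) * z"
      "rq (int (Suc n) + (- int r - 1)) = rq (int d)" "rq (int (Suc n) + (int r + 1)) = z"
      using 1 2 by (simp_all add: algebra_simps n)
    have 4: "q ^ n = x * y" "q ^ (3 * r + 3) = x ^ 3 * q ^ 3" "c = x * (1 + x * q)" "qf (Suc n) = qf n * (1 - q * (x * y))"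
      by (simp_all add: n x_def y_def c_def power_add power_mult qf_Suc mult.commute[of 3 r] power2_eq_square power3_eq_cube)
    show ?thesis
      unfolding g_def 1 2 3 4 by algebra
  qed
  moreover have "(\<lambda>n. g (Suc n) - g n) sums (c / P - g 0)"
    unfolding g_def by (intro telescope_sums telescope_limit)
  moreover have "g 0 = 0" by (simp add: g_def)
  ultimately have "(\<lambda>n. q ^ n * qf n * rq (int n - int r) * rq (int n + int r + 1)
      + q ^ (3 * r + 3) * (q ^ n * qf n * rq (int n - int (Suc r)) * rq (int n + int (Suc r) + 1)))
        sums (c / P)"
    by simp
  moreover have "(\<lambda>n. q ^ n * qf n * rq (int n - int r) * rq (int n + int r + 1)
      + q ^ (3 * r + 3) * (q ^ n * qf n * rq (int n - int (Suc r)) * rq (int n + int (Suc r) + 1)))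
        sums (S (int r) / P + q ^ (3 * r + 3) * (S (int (Suc r)) / P))"
    by (intro sums_add sums_mult R_S_sums)
  ultimately have "S (int r) / P + q ^ (3 * r + 3) * (S (int (Suc r)) / P) = c / P"
    by (rule sums_unique2[symmetric])
  hence "S (int r) + q ^ (3 * r + 3) * S (int (Suc r)) = c"
    using P_nonzero by (simp add: field_simps)
  thus ?thesis by (simp add: c_def algebra_simps)
qed

text \<open>Telescoping as for \<open>S\<close>. The equation is left undivided so that it holds at
  \<open>r = 0\<close>, where the second term drops out and \<open>R 0 = 1\<close> follows.\<close>

lemma R_rec:
  "(1 - q ^ (r + 1)) * R (int r) + q ^ (3 * r + 2) * (1 - q ^ r) * R (int (Suc r))
     = q ^ r * (1 - q ^ (2 * r + 1))"
proof -
  \<comment> \<open>At \<open>n = r\<close> only the first summand and \<open>g (Suc r)\<close>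
    survive in the difference equation below; comparing them yields this constant.\<close>
  define c where "c = q ^ r * (1 - q ^ (2 * r + 1))"
  define g where "g n = c * (qf n * rq (int n + (- int r - 1)) * rq (int n + int r))" for n
  have "(1 - q ^ (r + 1)) * (q ^ n * qf n * rq (int n - int r) * rq (int n + int r))
      + q ^ (3 * r + 2) * (1 - q ^ r) * (q ^ n * qf n * rq (int n - int (Suc r)) * rq (int n + int (Suc r)))
      = g (Suc n) - g n" for n
  proof (cases "n < r")
    case True
    thus ?thesis by (simp add: g_def)
  next
    case False
    then obtain d where n: "n = r + d"
      using le_Suc_ex by (metis not_less)
    define x y where "x = q ^ r" and "y = q ^ d"
    define z where "z = rq (int (2 * r + d + 1))"
    have 1: "rq (int n - int r) = rq (int d)" "rq (int n - int (Suc r)) = (1 - y) * rq (int d)"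
      using rq_step[of "int d"] by (simp_all add: n y_def)
    have "nat (int (2 * r + d + 1)) = r + r + d + 1" by simp
    hence 2: "rq (int n + int (Suc r)) = z" "rq (int n + int r) = (1 - x * x * y * q) * z"
      using rq_step[of "int (2 * r + d + 1)"]
      by (simp_all add: n z_def x_def y_def power_add power2_eq_square algebra_simps del: nat_int)
    have 3: "rq (int n + (- int r - 1)) = (1 - y) * rq (int d)"
      "rq (int (Suc n) + (- int r - 1)) = rq (int d)" "rq (int (Suc n) + int r) = z"
      using 1 2 by (simp_all add: algebra_simps n)
    have 4: "q ^ n = x * y" "q ^ (3 * r + 2) = x ^ 3 * q ^ 2" "c = x * (1 - x ^ 2 * q)"
      "q ^ (r + 1) = x * q" "q ^ r = x" "qf (Suc n) = qf n * (1 - q * (x * y))"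
      by (simp_all add: n x_def y_def c_def power_add power_mult qf_Suc mult.commute[of _ r] power2_eq_square power3_eq_cube)
    show ?thesis
      unfolding g_def 1 2 3 4 by algebra
  qed
  moreover have "(\<lambda>n. g (Suc n) - g n) sums (c / P - g 0)"
    unfolding g_def by (intro telescope_sums telescope_limit)
  moreover have "g 0 = 0" by (simp add: g_def)
  ultimately have "(\<lambda>n. (1 - q ^ (r + 1)) * (q ^ n * qf n * rq (int n - int r) * rq (int n + int r))
      + q ^ (3 * r + 2) * (1 - q ^ r) * (q ^ n * qf n * rq (int n - int (Suc r)) * rq (int n + int (Suc r))))
        sums (c / P)"
    by simp
  moreover have "(\<lambda>n. (1 - q ^ (r + 1)) * (q ^ n * qf n * rq (int n - int r) * rq (int n + int r))
      + q ^ (3 * r + 2) * (1 - q ^ r) * (q ^ n * qf n * rq (int n - int (Suc r)) * rq (int n + int (Suc r))))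
        sums ((1 - q ^ (r + 1)) * (R (int r) / P) + q ^ (3 * r + 2) * (1 - q ^ r) * (R (int (Suc r)) / P))"
    by (intro sums_add sums_mult R_S_sums)
  ultimately have "(1 - q ^ (r + 1)) * (R (int r) / P) + q ^ (3 * r + 2) * (1 - q ^ r) * (R (int (Suc r)) / P) = c / P"
    by (rule sums_unique2[symmetric])
  hence "((1 - q ^ (r + 1)) * R (int r) + q ^ (3 * r + 2) * (1 - q ^ r) * R (int (Suc r))) / P = c / P"
    by (simp add: add_divide_distrib)
  thus ?thesis
    using P_nonzero by (simp add: c_def)
qed

text \<open>The weights are those of the Hecke-Rogers series; \<open>1 + q ^ (j + 1)\<close> in
  \<open>T\<close> becomes \<open>1 + q ^ j\<close> there because the outer index is shifted by
  one.\<close>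

definition G :: "nat \<Rightarrow> complex" where
  "G = partial_theta 1 (\<lambda>j. 1 - q ^ (2 * j + 1))"

definition T :: "nat \<Rightarrow> complex" where
  "T = partial_theta 5 (\<lambda>j. 1 + q ^ (j + 1))"

lemma norm_factor_le: "norm (1 - q ^ k) \<le> 2" "norm (1 + q ^ k) \<le> 2"
  using norm_power_le_1[of k] norm_triangle_ineq4[of 1 "q ^ k"] norm_triangle_ineq[of 1 "q ^ k"]
  by (simp_all only: norm_one)

lemma G_rec: "G r = 1 - q ^ (2 * r + 1) - q ^ (3 * r + 2) * G (Suc r)"
  unfolding G_def by (subst partial_theta_rec) (auto intro: norm_factor_le simp del: power_Suc power_add)

lemma T_rec: "T r = 1 + q ^ (r + 1) - q ^ (3 * r + 4) * T (Suc r)"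
  unfolding T_def by (subst partial_theta_rec) (auto intro: norm_factor_le simp del: power_Suc power_add)

lemma G_T_bounded: "norm (G r) \<le> 2 * (\<Sum>\<^sub>\<infinity>n. norm q ^ n)" "norm (T r) \<le> 2 * (\<Sum>\<^sub>\<infinity>n. norm q ^ n)"
  unfolding G_def T_def partial_theta_def
  by (rule norm_infsum_nat_le, rule partial_theta_bound; simp add: norm_factor_le del: power_Suc power_add)+

lemma norm_power_le_q: "k > 0 \<Longrightarrow> norm (q ^ k) \<le> norm q"
  using norm_q power_decreasing[of 1 k "norm q"] by (simp add: norm_power)

text \<open>Both sides are bounded solutions of \<open>S_rec\<close>; the factor
  \<open>q ^ r\<close> accounts for the exponent \<open>3 * r + 4\<close> in \<open>T_rec\<close>
  against \<open>3 * r + 3\<close>.\<close>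

lemma S_eq: "S (int r) = q ^ r * T r"
proof (rule recurrence_unique[where X = "\<lambda>r. S (int r)" and r = r and ?r0.0 = 0])
  show "S (int r) = q ^ r * (1 + q ^ (r + 1)) - q ^ (3 * r + 3) * S (int (Suc r))" for r
    by (rule S_rec)
  show "q ^ r * T r = q ^ r * (1 + q ^ (r + 1)) - q ^ (3 * r + 3) * (q ^ Suc r * T (Suc r))" for r
    by (subst T_rec) (simp add: algebra_simps power_add numeral_eq_Suc)
  show "norm (q ^ (3 * r + 3)) \<le> norm q" for r
    by (rule norm_power_le_q) simp
  show "norm (S (int r)) \<le> norm P * (K * (\<Sum>\<^sub>\<infinity>n. norm q ^ n))" for r
    by (rule R_S_bounded)
  show "norm (q ^ r * T r) \<le> 1 * (2 * (\<Sum>\<^sub>\<infinity>n. norm q ^ n))" for r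
    unfolding norm_mult by (intro mult_mono norm_power_le_1 G_T_bounded) auto
qed simp

text \<open>Passing to \<open>(1 - R r) / (1 - q ^ r)\<close> turns \<open>R_rec\<close> into the
  recurrence of \<open>G\<close>. For \<open>r \<ge> 1\<close> the denominator has norm at least
  \<open>1 - norm q\<close>, so the quotient stays bounded; \<open>r = 0\<close> is read off from
  \<open>R_rec\<close> directly.\<close>

lemma R_eq: "R (int r) = 1 - (1 - q ^ r) * G r"
proof (cases "r = 0")
  case True
  thus ?thesis
    using R_rec[of 0] norm_q by auto
next
  case False
  have "(1 - R (int r)) / (1 - q ^ r) = G r"
  proof (rule recurrence_unique[where X = "\<lambda>r. (1 - R (int r)) / (1 - q ^ r)" and r = r and ?r0.0 = 1])
    show "(1 - R (int r)) / (1 - q ^ r)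
        = (1 - q ^ (2 * r + 1)) - q ^ (3 * r + 2) * ((1 - R (int (Suc r))) / (1 - q ^ Suc r))"
      if "r \<ge> 1" for r
    proof -
      define x where "x = q ^ r"
      have x: "q ^ (2 * r + 1) = x ^ 2 * q" "q ^ (3 * r + 2) = x ^ 3 * q ^ 2" "q ^ Suc r = x * q" "q ^ r = x"
        "q ^ (r + 1) = x * q"
        by (simp_all add: x_def power_add power_mult mult.commute[of _ r] power2_eq_square)
      have nz: "1 - x \<noteq> 0" "1 - x * q \<noteq> 0"
        using power_neq_1[of r] power_neq_1[of "Suc r"] that by (simp_all add: x_def mult.commute)
      have "(1 - R (int r)) * (1 - x * q)
          = ((1 - x ^ 2 * q) * (1 - x * q) - x ^ 3 * q ^ 2 * (1 - R (int (Suc r)))) * (1 - x)"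
        using R_rec[of r] unfolding x by algebra
      thus ?thesis
        unfolding x using nz by (simp add: divide_simps)
    qed
    show "G r = (1 - q ^ (2 * r + 1)) - q ^ (3 * r + 2) * G (Suc r)" for r
      by (rule G_rec)
    show "norm (q ^ (3 * r + 2)) \<le> norm q" for r
      by (rule norm_power_le_q) simp
    show "norm (G r) \<le> 2 * (\<Sum>\<^sub>\<infinity>n. norm q ^ n)" for r
      by (rule G_T_bounded)
    show "norm ((1 - R (int r)) / (1 - q ^ r))
            \<le> (1 + norm P * (K * (\<Sum>\<^sub>\<infinity>n. norm q ^ n))) / (1 - norm q)" if "r \<ge> 1" for r
    proof -
      have "1 - norm q \<le> norm (1 - q ^ r)"
        using norm_power_le_q[of r] that norm_triangle_ineq2[of 1 "q ^ r"] by simp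
      moreover have "norm (1 - R (int r)) \<le> 1 + norm P * (K * (\<Sum>\<^sub>\<infinity>n. norm q ^ n))"
        using norm_triangle_ineq4[of 1 "R (int r)"] R_S_bounded(1)[of "int r"] by simp
      ultimately show ?thesis
        unfolding norm_divide using norm_q
        by (intro frac_le) (auto intro: order_trans[OF norm_ge_zero])
    qed
  qed (use False in auto)
  thus ?thesis
    using power_neq_1[of r] False by (simp add: field_simps)
qed

text \<open>Since \<open>q * S 0 = 1 - P\<close> by telescoping, this is Euler's pentagonal number theorem.\<close>

lemma P_eq_G0: "P = G 0"
proof -
  have int_Suc_diff: "int (Suc n) - 1 = int n" for n
    by simp
  have tele: "q * (q ^ n * qf n * rq (int n - 0) * rq (int n + 0 + 1)) = rq (int (Suc n)) - rq (int n)" for n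
  proof -
    have "rq (int n) = (1 - q ^ Suc n) * rq (int (Suc n))"
      using rq_step[of "int (Suc n)"] by (simp only: nat_int int_Suc_diff)
    hence "rq (int (Suc n)) - rq (int n) = q * q ^ n * rq (int (Suc n))"
      by (simp add: algebra_simps)
    moreover have "qf n * rq (int n) = 1"
      by (simp add: rq_def)
    hence "q * (q ^ n * qf n * rq (int n - 0) * rq (int n + 0 + 1)) = q * q ^ n * rq (int n + 1)"
      by (simp add: mult.assoc mult.left_commute[of "qf n"])
    ultimately show ?thesis by (simp add: add.commute)
  qed
  have "(\<lambda>n. rq (int n)) \<longlonglongrightarrow> 1 / P"
    using rq_tendsto[of 0] by simp
  hence "(\<lambda>n. rq (int (Suc n)) - rq (int n)) sums (1 / P - rq (int 0))"
    by (rule telescope_sums)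
  moreover have "(\<lambda>n. rq (int (Suc n)) - rq (int n)) sums (q * (S 0 / P))"
    using sums_mult[OF R_S_sums(2)[of 0], of q] unfolding tele .
  ultimately have "q * (S 0 / P) = 1 / P - 1"
    using sums_unique2 by fastforce
  hence P: "P = 1 - q * T 0"
    using P_nonzero S_eq[of 0] by (simp add: field_simps)
  \<comment> \<open>In \<open>g n + q * h n\<close> the two middle powers cancel and
    \<open>t n - t (Suc n)\<close> remains, whence \<open>G 0 + q * T 0 = 1\<close>.\<close>
  define t where "t n = (- 1) ^ n * q ^ (n * (3 * n + 1) div 2)" for n
  define g where "g n = (- 1) ^ n * q ^ (3 * 0 * n + n * (3 * n + 1) div 2) * (1 - q ^ (2 * (0 + n) + 1))" for n
  define h where "h n = (- 1) ^ n * q ^ (3 * 0 * n + n * (3 * n + 5) div 2) * (1 + q ^ ((0 + n) + 1))" for n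
  have "g n + q * h n = t n - t (Suc n)" for n
  proof -
    obtain u where u: "n * (3 * n + 1) = 2 * u"
      by (metis dvdE even_add even_mult_iff odd_numeral odd_one)
    have e: "n * (3 * n + 1) div 2 = u" "n * (3 * n + 5) div 2 = u + 2 * n" "Suc n * (3 * Suc n + 1) div 2 = u + 3 * n + 2"
      using u by (auto simp: algebra_simps)
    thus ?thesis
      unfolding g_def h_def t_def e by (simp add: algebra_simps power_add power2_eq_square numeral_eq_Suc)
  qed
  moreover have "t \<longlonglongrightarrow> 0"
  proof (rule Lim_null_comparison)
    have "norm (t n) \<le> norm q ^ n" for n
    proof -
      have "n * 2 \<le> n * (3 * n + 1)" by (cases n) auto
      hence "n \<le> n * (3 * n + 1) div 2" by linarith
      thus ?thesis
        using norm_q by (auto simp: t_def norm_mult norm_power intro!: power_decreasing)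
    qed
    thus "eventually (\<lambda>n. norm (t n) \<le> norm q ^ n) sequentially" by simp
    show "(\<lambda>n. norm q ^ n) \<longlonglongrightarrow> 0"
      using norm_q by (intro LIMSEQ_realpow_zero) auto
  qed
  ultimately have "(\<lambda>n. g n + q * h n) sums (t 0 - 0)"
    using telescope_sums'[of t 0] by simp
  moreover have "g sums G 0" "h sums T 0"
    unfolding g_def h_def G_def T_def partial_theta_def
    by (rule has_sum_imp_sums, rule has_sum_infsum, rule summable_nat, rule partial_theta_bound;
        simp add: norm_factor_le del: power_Suc power_add)+
  hence "(\<lambda>n. g n + q * h n) sums (G 0 + q * T 0)"
    by (intro sums_add sums_mult)
  ultimately have "G 0 + q * T 0 = t 0 - 0"
    using sums_unique2 by blast
  hence "G 0 = 1 - q * T 0"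
    by (simp add: t_def eq_diff_eq)
  with P show ?thesis by simp
qed

subsection \<open>The Hecke--Rogers series\<close>

lemma qf_mult_qpoch: "qf n * qpoch (q ^ (n + 1)) q k = qf (n + k)"
  by (induction k) (simp_all add: qpoch_def qf_Suc power_add mult.assoc)

lemma chi_term: "q ^ n / qpoch (q ^ (n + 1)) q k = q ^ n * qf n * rq (int (n + k))"
  using qf_mult_qpoch[of n k, symmetric] qf_nonzero[of n] qpoch_nonzero[OF norm_q, of n k]
  by (simp add: rq_def nat_int_add)

lemma alternating_swap:
  assumes b: "\<And>n j. norm (b n j) \<le> C * norm q ^ n" and c: "\<And>n j. norm (c n j) \<le> C * norm q ^ n"
  shows "(\<Sum>\<^sub>\<infinity>n. \<Sum>\<^sub>\<infinity>j. a1 j * b n j - a2 j * c n j)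
       = (\<Sum>\<^sub>\<infinity>j. a1 j * (\<Sum>\<^sub>\<infinity>n. b n j) - a2 j * (\<Sum>\<^sub>\<infinity>n. c n j))"
proof -
  have "norm (a1 j * b n j - a2 j * c n j) \<le> 2 * C * (norm q ^ n * norm q ^ nat \<bar>j\<bar>)" for n j
  proof -
    have "norm (a1 j * b n j - a2 j * c n j) \<le> norm (a1 j) * norm (b n j) + norm (a2 j) * norm (c n j)"
      by (metis norm_mult norm_triangle_ineq4)
    also have "\<dots> \<le> norm q ^ nat \<bar>j\<bar> * (C * norm q ^ n) + norm q ^ nat \<bar>j\<bar> * (C * norm q ^ n)"
      by (intro add_mono mult_mono a_bounds b c) auto
    finally show ?thesis by (simp add: mult_ac)
  qed
  hence "(\<Sum>\<^sub>\<infinity>n. \<Sum>\<^sub>\<infinity>j. a1 j * b n j - a2 j * c n j) = (\<Sum>\<^sub>\<infinity>j. \<Sum>\<^sub>\<infinity>n. a1 j * b n j - a2 j * c n j)"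
    by (intro infsum_swap_banach summable_nat_int)
  moreover have "(\<Sum>\<^sub>\<infinity>n. a1 j * b n j - a2 j * c n j) = a1 j * (\<Sum>\<^sub>\<infinity>n. b n j) - a2 j * (\<Sum>\<^sub>\<infinity>n. c n j)" for j
  proof -
    have "(\<lambda>n. b n j) summable_on UNIV" "(\<lambda>n. c n j) summable_on UNIV"
      by (rule summable_nat[OF b], rule summable_nat[OF c])
    thus ?thesis
      by (simp add: infsum_diff_complex summable_on_cmult_right infsum_cmult_right)
  qed
  ultimately show ?thesis by simp
qed

section \<open>Inserting the Bailey pairs into the mock theta functions\<close>

lemma P_chi0: "P * chi0 q = (\<Sum>\<^sub>\<infinity>j. a1 j * R (3 * j) - a2 j * R (3 * j + 1))"
proof -
  define b where "b r n = q ^ n * qf n * rq (int n - r) * rq (int n + r)" for r n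
  have b: "norm (b r n) \<le> K * norm q ^ n" for r n
    unfolding b_def by (rule weighted_product_bound)
  have R: "R r = P * infsum (b r) UNIV" for r
    unfolding R_def b_def ..
  have "q ^ n / qpoch (q ^ (n + 1)) q n = (\<Sum>\<^sub>\<infinity>j. a1 j * b (3 * j) n - a2 j * b (3 * j + 1) n)" for n
  proof -
    have "int (n + n) = 2 * int n"
      by simp
    hence "q ^ n / qpoch (q ^ (n + 1)) q n = q ^ n * qf n * infsum (bailey_even n) UNIV"
      using bailey_even_odd[of n] by (simp only: chi_term)
    also have "\<dots> = (\<Sum>\<^sub>\<infinity>j. q ^ n * qf n * bailey_even n j)"
      by (rule infsum_cmult_right'[symmetric])
    finally show ?thesis
      by (simp add: bailey_even_def b_def algebra_simps)
  qed
  hence "chi0 q = (\<Sum>\<^sub>\<infinity>n. \<Sum>\<^sub>\<infinity>j. a1 j * b (3 * j) n - a2 j * b (3 * j + 1) n)"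
    unfolding chi0_def by (simp only:)
  also have "\<dots> = (\<Sum>\<^sub>\<infinity>j. a1 j * infsum (b (3 * j)) UNIV - a2 j * infsum (b (3 * j + 1)) UNIV)"
    by (rule alternating_swap[OF b b])
  finally have "P * chi0 q = (\<Sum>\<^sub>\<infinity>j. P * (a1 j * infsum (b (3 * j)) UNIV - a2 j * infsum (b (3 * j + 1)) UNIV))"
    by (simp only: infsum_cmult_right')
  thus ?thesis
    by (simp add: R algebra_simps)
qed

lemma P_chi1: "P * chi1 q = (\<Sum>\<^sub>\<infinity>j. a1 j * S (3 * j) - a2 j * S (3 * j + 1))"
proof -
  define b where "b r n = q ^ n * qf n * rq (int n - r) * rq (int n + r + 1)" for r n
  have b: "norm (b r n) \<le> K * norm q ^ n" for r n
    unfolding b_def by (rule weighted_product_bound)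
  have S: "S r = P * infsum (b r) UNIV" for r
    unfolding S_def b_def ..
  have "q ^ n / qpoch (q ^ (n + 1)) q (n + 1) = (\<Sum>\<^sub>\<infinity>j. a1 j * b (3 * j) n - a2 j * b (3 * j + 1) n)" for n
  proof -
    have "int (n + (n + 1)) = 2 * int n + 1"
      by simp
    hence "q ^ n / qpoch (q ^ (n + 1)) q (n + 1) = q ^ n * qf n * infsum (bailey_odd n) UNIV"
      using bailey_even_odd[of n] by (simp only: chi_term)
    also have "\<dots> = (\<Sum>\<^sub>\<infinity>j. q ^ n * qf n * bailey_odd n j)"
      by (rule infsum_cmult_right'[symmetric])
    finally show ?thesis
      by (simp add: bailey_odd_def b_def algebra_simps)
  qed
  hence "chi1 q = (\<Sum>\<^sub>\<infinity>n. \<Sum>\<^sub>\<infinity>j. a1 j * b (3 * j) n - a2 j * b (3 * j + 1) n)"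
    unfolding chi1_def by (simp only:)
  also have "\<dots> = (\<Sum>\<^sub>\<infinity>j. a1 j * infsum (b (3 * j)) UNIV - a2 j * infsum (b (3 * j + 1)) UNIV)"
    by (rule alternating_swap[OF b b])
  finally have "P * chi1 q = (\<Sum>\<^sub>\<infinity>j. P * (a1 j * infsum (b (3 * j)) UNIV - a2 j * infsum (b (3 * j + 1)) UNIV))"
    by (simp only: infsum_cmult_right')
  thus ?thesis
    by (simp add: S algebra_simps)
qed

section \<open>From wedge sums to partial theta series\<close>

lemma weighted_summable:
  fixes g F :: "int \<Rightarrow> complex"
  assumes "\<And>m. norm (g m) \<le> norm q ^ nat \<bar>m\<bar>" "\<And>m. norm (F m) \<le> B"
  shows "(\<lambda>m. g m * F m) summable_on UNIV"
proof (rule summable_int)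
  show "norm (g m * F m) \<le> B * norm q ^ nat \<bar>m\<bar>" for m
    using mult_mono[OF assms(1)[of m] assms(2)[of m]] by (simp add: norm_mult mult.commute)
qed

text \<open>Common form of the four double sums: for fixed \<open>m\<close> the sum over
  \<open>j = n + s m\<close> is a multiple of a partial theta series. The start \<open>s m\<close>
  and the theta index \<open>r m\<close> are kept apart because they differ by one for
  \<open>chi1\<close>.\<close>

lemma infsum_hecke:
  fixes f :: "nat \<Rightarrow> int \<Rightarrow> complex"
  assumes h: "c > 0" "\<And>n. norm (h n) \<le> 2"
    and g: "\<And>m. norm (g m) \<le> norm q ^ nat \<bar>m\<bar>"
    and f: "\<And>n m. f (n + s m) m
              = g m * ((- 1) ^ n * q ^ (3 * r m * n + n * (3 * n + c) div 2) * h (r m + n))"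
    and A: "\<And>m. {s m..} \<subseteq> A"
    and M: "\<And>j. M j \<subseteq> {- int j - 1..int j + 1}" "\<And>j m. j \<in> A \<Longrightarrow> m \<in> M j \<longleftrightarrow> s m \<le> j"
  shows "(\<Sum>\<^sub>\<infinity>j\<in>A. \<Sum>m\<in>M j. f j m) = (\<Sum>\<^sub>\<infinity>m. g m * partial_theta c h (r m))"
proof -
  note t = partial_theta_bound[of c h, OF h]
  have "norm (f (n + s m) m) \<le> 2 * (norm q ^ n * norm q ^ nat \<bar>m\<bar>)" for n m
    unfolding f using mult_mono[OF g[of m] t[of n "r m"]] by (simp add: norm_mult mult_ac)
  hence "(\<Sum>\<^sub>\<infinity>j\<in>A. \<Sum>m\<in>M j. f j m) = (\<Sum>\<^sub>\<infinity>m. \<Sum>\<^sub>\<infinity>n. f (n + s m) m)"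
    using A M by (intro infsum_columns summable_nat_int) (auto intro: finite_subset[OF M(1)])
  moreover have "(\<Sum>\<^sub>\<infinity>n. f (n + s m) m) = g m * partial_theta c h (r m)" for m
    unfolding f partial_theta_def using summable_nat[OF t] by (intro infsum_cmult_right) auto
  ultimately show ?thesis by simp
qed

text \<open>The exponents are compared after doubling, where no \<open>div\<close> occurs and the
  identity can be checked by ring arithmetic; parity makes the halving exact.\<close>

lemma hecke_power:
  assumes "even u" "even v" "odd c" "0 \<le> a"
    and "u - v - 2 * s = 2 * a + 2 * int e + 6 * int r * int n + int n * (3 * int n + int c)"
  shows "q powi (u div 2 - v div 2 - s) = q ^ nat a * q ^ e * q ^ (3 * r * n + n * (3 * n + c) div 2)"
proof -
  obtain u' v' where uv: "u = 2 * u'" "v = 2 * v'"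
    using assms(1,2) by (elim evenE)
  obtain w where w: "n * (3 * n + c) = 2 * w"
    using assms(3) by (metis dvdE even_add even_mult_iff odd_numeral)
  have "int n * (3 * int n + int c) = 2 * int w"
    using arg_cong[OF w, of int] by simp
  hence "u div 2 - v div 2 - s = a + int e + 3 * int r * int n + int w"
    using assms(5) unfolding uv by simp
  also have "\<dots> = int (nat a + e + (3 * r * n + w))"
    using assms(4) by simp
  finally show ?thesis
    unfolding w by (simp only: power_int_of_nat power_add) simp
qed

lemma S_theta:
  "S (3 * m) = q ^ nat (if m \<ge> 0 then 3 * m else - 3 * m - 1) * T (nat (if m \<ge> 0 then 3 * m else - 3 * m - 1))"
  "S (3 * m + 1) = q ^ nat (if m \<ge> 0 then 3 * m + 1 else - 3 * m - 2) * T (nat (if m \<ge> 0 then 3 * m + 1 else - 3 * m - 2))"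
proof -
  have "3 * m = int (nat (3 * m))" "3 * m + 1 = int (nat (3 * m + 1))" if "m \<ge> 0"
    using that by auto
  moreover have "3 * m = - 1 - int (nat (- 3 * m - 1))" "3 * m + 1 = - 1 - int (nat (- 3 * m - 2))" if "\<not> m \<ge> 0"
    using that by auto
  ultimately show
    "S (3 * m) = q ^ nat (if m \<ge> 0 then 3 * m else - 3 * m - 1) * T (nat (if m \<ge> 0 then 3 * m else - 3 * m - 1))"
    "S (3 * m + 1) = q ^ nat (if m \<ge> 0 then 3 * m + 1 else - 3 * m - 2) * T (nat (if m \<ge> 0 then 3 * m + 1 else - 3 * m - 2))"
    by (metis S_reflect S_eq)+
qed

lemma R_theta: "R r = 1 - (1 - q ^ nat \<bar>r\<bar>) * G (nat \<bar>r\<bar>)"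
  using R_eq[of "nat \<bar>r\<bar>"] R_minus[of r] by (auto simp: abs_if split: if_splits)

lemma a_weight_bounds:
  assumes "norm w \<le> 1"
  shows "norm (a1 m * w) \<le> norm q ^ nat \<bar>m\<bar>" "norm (a2 m * w) \<le> norm q ^ nat \<bar>m\<bar>"
  using mult_mono[OF a_bounds(1)[of m] assms] mult_mono[OF a_bounds(2)[of m] assms]
  by (simp_all add: norm_mult)

text \<open>The second series for \<open>\<chi>\<^sub>1\<close> is indexed by \<open>- 1 - m\<close> relative to the Bailey pair.\<close>

lemma a2_reflect_bound: "norm (a2 (- 1 - m) * q ^ r) \<le> norm q ^ nat \<bar>m\<bar>"
proof -
  have "\<bar>m\<bar> \<le> (- 1 - m) * (6 * (- 1 - m) + 5) + 1"
    using square_ge_abs[of m] square_ge_abs[of "m + 1"] by (auto simp: algebra_simps abs_if split: if_splits)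
  hence "norm (a2 (- 1 - m)) \<le> norm q ^ nat \<bar>m\<bar>"
    unfolding a2_def norm_power using norm_q by (intro power_decreasing nat_mono) auto
  from mult_mono[OF this norm_power_le_1[of r]] show ?thesis
    by (simp add: norm_mult)
qed

section \<open>The two Hecke-Rogers expansions\<close>

lemma hecke_chi1:
  "P * chi1 q =
      (\<Sum>\<^sub>\<infinity>j::nat\<in>{1..}. \<Sum>m | - int j \<le> 3 * m \<and> 3 * m \<le> int j - 1.
         sg m * (- 1) powi (m + int j + 1)
           * q powi (int j * (3 * int j - 1) div 2 - m * (15 * m + 7) div 2 - 1)
           * (1 + q ^ j))
    + (\<Sum>\<^sub>\<infinity>j::nat\<in>{1..}. \<Sum>m | - int j - 1 \<le> 3 * m \<and> 3 * m \<le> int j - 2.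
         sg m * (- 1) powi (m + int j + 1)
           * q powi (int j * (3 * int j - 1) div 2 - m * (15 * m + 13) div 2 - 2)
           * (1 + q ^ j))" (is "_ = ?H1 + ?H2")
proof -
  \<comment> \<open>These are the nonnegative representatives of \<open>3 * m\<close> and
    \<open>3 * m + 1\<close> under \<open>S_reflect\<close>. The least \<open>j\<close> admitting
    \<open>m\<close> in the two wedges is \<open>r1 m + 1\<close> and
    \<open>r2 m + 1\<close>.\<close>
  define r1 r2 :: "int \<Rightarrow> nat"
    where "r1 m = nat (if m \<ge> 0 then 3 * m else - 3 * m - 1)"
      and "r2 m = nat (if m \<ge> 0 then 3 * m + 1 else - 3 * m - 2)" for m
  have H1: "?H1 = (\<Sum>\<^sub>\<infinity>m. a1 m * q ^ r1 m * T (r1 m))"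
    unfolding T_def
  proof (rule infsum_hecke[where s = "\<lambda>m. r1 m + 1"])
    fix n m
    let ?j = "n + (r1 m + 1)"
    \<comment> \<open>The parity of \<open>m + r1 m\<close> changes with the sign of
      \<open>m\<close>, and \<open>sg m\<close> compensates for this.\<close>
    have "sg m * (- 1) powi (m + int ?j + 1) = (- 1) ^ n"
      by (cases "m \<ge> 0") (auto simp: sg_def r1_def minus_one_powi_eq power_int_add)
    moreover have "q powi (int ?j * (3 * int ?j - 1) div 2 - m * (15 * m + 7) div 2 - 1)
        = q ^ nat (m * (6 * m + 1)) * q ^ r1 m * q ^ (3 * r1 m * n + n * (3 * n + 5) div 2)"
      using abs_le_pentagonal(1)[of m]
      by (intro hecke_power) (auto simp: r1_def algebra_simps)
    ultimately show "sg m * (- 1) powi (m + int ?j + 1)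
           * q powi (int ?j * (3 * int ?j - 1) div 2 - m * (15 * m + 7) div 2 - 1) * (1 + q ^ ?j)
        = a1 m * q ^ r1 m * ((- 1) ^ n * q ^ (3 * r1 m * n + n * (3 * n + 5) div 2) * (1 + q ^ (r1 m + n + 1)))"
      by (simp add: a1_def add_ac mult_ac)
    show "norm (a1 m * q ^ r1 m) \<le> norm q ^ nat \<bar>m\<bar>"
      by (intro a_weight_bounds norm_power_le_1)
  qed (auto intro: norm_factor_le simp: r1_def simp del: power_Suc power_add split: if_splits)
  have H2: "?H2 = (\<Sum>\<^sub>\<infinity>m. (- (a2 (- 1 - m) * q ^ r2 m)) * T (r2 m))"
    unfolding T_def
  proof (rule infsum_hecke[where s = "\<lambda>m. r2 m + 1"])
    fix n :: nat and m :: int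
    let ?j = "n + (r2 m + 1)"
    have "sg m * (- 1) powi (m + int ?j + 1) = - ((- 1) ^ n)"
      by (cases "m \<ge> 0") (auto simp: sg_def r2_def minus_one_powi_eq power_int_add)
    moreover have "q powi (int ?j * (3 * int ?j - 1) div 2 - m * (15 * m + 13) div 2 - 2)
        = q ^ nat ((- 1 - m) * (6 * (- 1 - m) + 5) + 1) * q ^ r2 m * q ^ (3 * r2 m * n + n * (3 * n + 5) div 2)"
      using abs_le_pentagonal(2)[of "- 1 - m"]
      by (intro hecke_power) (auto simp: r2_def algebra_simps)
    ultimately show "sg m * (- 1) powi (m + int ?j + 1)
           * q powi (int ?j * (3 * int ?j - 1) div 2 - m * (15 * m + 13) div 2 - 2) * (1 + q ^ ?j)
        = - (a2 (- 1 - m) * q ^ r2 m) * ((- 1) ^ n * q ^ (3 * r2 m * n + n * (3 * n + 5) div 2) * (1 + q ^ (r2 m + n + 1)))"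
      by (simp add: a2_def add_ac mult_ac)
    show "norm (- (a2 (- 1 - m) * q ^ r2 m)) \<le> norm q ^ nat \<bar>m\<bar>"
      unfolding norm_minus_cancel by (rule a2_reflect_bound)
  qed (auto intro: norm_factor_le simp: r2_def simp del: power_Suc power_add split: if_splits)
  have s: "(\<lambda>m. a1 m * S (3 * m)) summable_on UNIV" "(\<lambda>m. a2 m * S (3 * m + 1)) summable_on UNIV"
    by (rule weighted_summable; rule a_bounds R_S_bounded)+
  have "?H2 = (\<Sum>\<^sub>\<infinity>m. - (a2 (- 1 - m) * S (3 * (- 1 - m) + 1)))"
  proof -
    \<comment> \<open>Here \<open>3 * (- 1 - m) + 1 = - 1 - (3 * m + 1)\<close>, so
      \<open>S_reflect\<close> applies.\<close>
    have "S (3 * (- 1 - m) + 1) = q ^ r2 m * T (r2 m)" for m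
      using S_reflect[of "3 * m + 1"] S_theta(2)[of m] by (simp add: r2_def algebra_simps)
    thus ?thesis
      unfolding H2 by (simp only: mult.assoc mult_minus_left)
  qed
  also have "\<dots> = - (\<Sum>\<^sub>\<infinity>m. a2 (- 1 - m) * S (3 * (- 1 - m) + 1))"
    by (rule infsum_uminus)
  also have "(\<Sum>\<^sub>\<infinity>m. a2 (- 1 - m) * S (3 * (- 1 - m) + 1)) = (\<Sum>\<^sub>\<infinity>m. a2 m * S (3 * m + 1))"
    by (rule infsum_reindex_bij_betw[where g = "\<lambda>m. - 1 - m" and f = "\<lambda>m. a2 m * S (3 * m + 1)"])
      (simp add: bij_def inj_def surj_def)
  finally have H2': "?H2 = - (\<Sum>\<^sub>\<infinity>m. a2 m * S (3 * m + 1))" .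
  have "?H1 = (\<Sum>\<^sub>\<infinity>m. a1 m * S (3 * m))"
    unfolding H1 S_theta r1_def by (simp only: mult.assoc)
  thus ?thesis
    unfolding H2' P_chi1 infsum_diff_complex[OF s] by simp
qed

text \<open>Unlike for \<open>chi1\<close>, the terms of the two sides do not agree for each
  \<open>m\<close>. Their discrepancies cancel between \<open>m\<close> and \<open>- m\<close>, and
  \<open>m = 0\<close> leaves \<open>2 * P\<close>, the source of the 2 subtracted from
  \<open>chi0 q\<close>.\<close>

lemma hecke_chi0:
  "P * (chi0 q - 2) =
      (\<Sum>\<^sub>\<infinity>j::nat\<in>{0..}. \<Sum>m | - int j \<le> 3 * m \<and> 3 * m \<le> int j.
         sg m * (- 1) powi (m + int j + 1)
           * q powi (int j * (3 * int j + 1) div 2 - m * (15 * m + 1) div 2)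
           * (1 - q ^ (2 * j + 1)))
    + (\<Sum>\<^sub>\<infinity>j::nat\<in>{1..}. \<Sum>m | - int j - 1 \<le> 3 * m \<and> 3 * m \<le> int j - 1.
         sg m * (- 1) powi (m + int j + 1)
           * q powi (int j * (3 * int j + 1) div 2 - m * (15 * m + 11) div 2 - 1)
           * (1 - q ^ (2 * j + 1)))" (is "_ = ?H1 + ?H2")
proof -
  define r1 r2 where "r1 m = nat \<bar>3 * m\<bar>" and "r2 m = nat \<bar>3 * m + 1\<bar>" for m :: int
  \<comment> \<open>By \<open>R_theta\<close>, \<open>R\<close> contains both \<open>- G r\<close>
    and \<open>q ^ r * G r\<close>. The Hecke-Rogers series keeps only the first for
    \<open>m \<ge> 0\<close> and only the second for \<open>m < 0\<close>; \<open>w2\<close>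
    includes the minus sign in front of \<open>a2\<close>.\<close>
  define w1 w2 where "w1 m = (if m \<ge> 0 then - 1 else q ^ r1 m)"
    and "w2 m = (if m \<ge> 0 then 1 else - (q ^ r2 m))" for m :: int
  have w: "norm (w1 m) \<le> 1" "norm (w2 m) \<le> 1" for m
    using norm_power_le_1 by (auto simp: w1_def w2_def)
  have H1: "?H1 = (\<Sum>\<^sub>\<infinity>m. a1 m * w1 m * G (r1 m))"
    unfolding G_def
  proof (rule infsum_hecke[where s = r1])
    fix n m
    let ?j = "n + r1 m"
    have "sg m * (- 1) powi (m + int ?j + 1) = (if m \<ge> 0 then - 1 else 1) * (- 1) ^ n"
      by (cases "m \<ge> 0") (auto simp: sg_def r1_def minus_one_powi_eq power_int_add)
    moreover have "q powi (int ?j * (3 * int ?j + 1) div 2 - m * (15 * m + 1) div 2 - 0)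
        = q ^ nat (m * (6 * m + 1)) * q ^ (if m \<ge> 0 then 0 else r1 m) * q ^ (3 * r1 m * n + n * (3 * n + 1) div 2)"
      using abs_le_pentagonal(1)[of m]
      by (intro hecke_power) (auto simp: r1_def algebra_simps)
    ultimately show "sg m * (- 1) powi (m + int ?j + 1)
           * q powi (int ?j * (3 * int ?j + 1) div 2 - m * (15 * m + 1) div 2) * (1 - q ^ (2 * ?j + 1))
        = a1 m * w1 m * ((- 1) ^ n * q ^ (3 * r1 m * n + n * (3 * n + 1) div 2) * (1 - q ^ (2 * (r1 m + n) + 1)))"
      by (simp add: a1_def w1_def add_ac mult_ac)
    show "norm (a1 m * w1 m) \<le> norm q ^ nat \<bar>m\<bar>"
      by (intro a_weight_bounds w)
  qed (auto intro: norm_factor_le simp: r1_def simp del: power_Suc power_add)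
  \<comment> \<open>The second outer sum starts at 1, so every wedge has to start there or
    later.\<close>
  have r2_pos: "r2 m \<ge> 1" for m
  proof -
    have "3 * m + 1 \<noteq> 0" by presburger
    thus ?thesis by (simp add: r2_def)
  qed
  have H2: "?H2 = (\<Sum>\<^sub>\<infinity>m. a2 m * w2 m * G (r2 m))"
    unfolding G_def
  proof (rule infsum_hecke[where s = r2])
    fix n m
    let ?j = "n + r2 m"
    have "sg m * (- 1) powi (m + int ?j + 1) = (if m \<ge> 0 then 1 else - 1) * (- 1) ^ n"
      by (cases "m \<ge> 0") (auto simp: sg_def r2_def minus_one_powi_eq power_int_add)
    moreover have "q powi (int ?j * (3 * int ?j + 1) div 2 - m * (15 * m + 11) div 2 - 1)
        = q ^ nat (m * (6 * m + 5) + 1) * q ^ (if m \<ge> 0 then 0 else r2 m) * q ^ (3 * r2 m * n + n * (3 * n + 1) div 2)"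
      using abs_le_pentagonal(2)[of m]
      by (intro hecke_power) (auto simp: r2_def algebra_simps)
    ultimately show "sg m * (- 1) powi (m + int ?j + 1)
           * q powi (int ?j * (3 * int ?j + 1) div 2 - m * (15 * m + 11) div 2 - 1) * (1 - q ^ (2 * ?j + 1))
        = a2 m * w2 m * ((- 1) ^ n * q ^ (3 * r2 m * n + n * (3 * n + 1) div 2) * (1 - q ^ (2 * (r2 m + n) + 1)))"
      by (simp add: a2_def w2_def add_ac mult_ac)
    show "norm (a2 m * w2 m) \<le> norm q ^ nat \<bar>m\<bar>"
      by (intro a_weight_bounds w)
  qed (use r2_pos in \<open>auto intro: norm_factor_le order_trans simp: r2_def simp del: power_Suc power_add\<close>)
  have s1: "(\<lambda>m. a1 m * w1 m * G (r1 m)) summable_on UNIV" "(\<lambda>m. a2 m * w2 m * G (r2 m)) summable_on UNIV"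
    by (rule weighted_summable; auto intro: a_weight_bounds w G_T_bounded)+
  have s2: "(\<lambda>m. a1 m * R (3 * m) - a2 m * R (3 * m + 1)) summable_on UNIV"
    by (rule summable_on_diff_complex; rule weighted_summable; rule a_bounds R_S_bounded)
  define D where "D m = (a1 m * R (3 * m) - a2 m * R (3 * m + 1)) - (a1 m * w1 m * G (r1 m) + a2 m * w2 m * G (r2 m))" for m
  have "P * chi0 q - (?H1 + ?H2) = infsum D UNIV"
    unfolding P_chi0 H1 H2 D_def
    by (simp only: infsum_add[OF s1] infsum_diff_complex[OF s2 summable_on_add[OF s1]])
  \<comment> \<open>the terms for \<open>m\<close> and \<open>- m\<close> are matched by the recurrence of \<open>G\<close>\<close>
  also have "\<dots> = D 0"
  proof (rule infsum_odd_off_zero)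
    show "D summable_on UNIV"
      unfolding D_def by (intro summable_on_diff_complex[OF s2] summable_on_add s1)
  next
    fix k :: int
    assume "k > 0"
    then obtain i where k: "k = int i + 1"
      by (metis pos_int_cases of_nat_Suc Suc_pred add.commute)
    \<comment> \<open>\<open>X\<close> is the lowest of the four pentagonal powers at
      \<open>k\<close> and \<open>- k\<close>; the others are \<open>X\<close> times powers of
      \<open>y\<close> and \<open>q\<close>. The indices of \<open>G\<close> that occur are
      \<open>m\<close>, \<open>Suc m\<close> and \<open>Suc (Suc m)\<close>, and two uses of
      \<open>G_rec\<close> eliminate the first two.\<close>
    define X y where "X = a2 (- k)" and "y = q ^ i"
    have X: "X = q ^ (6 * i * i + 7 * i + 2)"
      unfolding X_def a2_def k by (rule arg_cong[where f = "(^) q"]) (simp add: nat_eq_iff algebra_simps)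
    have "nat (k * (6 * k + 1)) = 6 * i * i + 7 * i + 2 + (i * 6 + 5)"
      "nat (- k * (6 * - k + 1)) = 6 * i * i + 7 * i + 2 + (i * 4 + 3)"
      "nat (k * (6 * k + 5) + 1) = 6 * i * i + 7 * i + 2 + (i * 10 + 10)"
      unfolding k by (simp_all add: nat_eq_iff algebra_simps)
    hence a: "a1 k = X * y ^ 6 * q ^ 5" "a1 (- k) = X * y ^ 4 * q ^ 3" "a2 k = X * y ^ 10 * q ^ 10"
      unfolding a1_def a2_def X y_def by (simp_all only: power_add power_mult mult.assoc)
    define m where "m = 3 * i + 2"
    have r: "nat \<bar>3 * k\<bar> = Suc m" "nat \<bar>3 * - k\<bar> = Suc m" "nat \<bar>3 * k + 1\<bar> = Suc (Suc m)" "nat \<bar>3 * - k + 1\<bar> = m"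
      by (simp_all add: k m_def)
    have qm: "q ^ m = y ^ 3 * q ^ 2"
      by (simp only: m_def y_def power_add power_mult mult.commute[of 3 i])
    have G: "G m = 1 - y ^ 6 * q ^ 5 - y ^ 9 * q ^ 8 * G (Suc m)"
    proof -
      have "2 * m + 1 = i * 6 + 5" "3 * m + 2 = i * 9 + 8" by (simp_all add: m_def)
      thus ?thesis by (subst G_rec) (simp only: y_def power_add power_mult)
    qed
    have G': "G (Suc m) = 1 - y ^ 6 * q ^ 7 - y ^ 9 * q ^ 11 * G (Suc (Suc m))"
    proof -
      have "2 * Suc m + 1 = i * 6 + 7" "3 * Suc m + 2 = i * 9 + 11" by (simp_all add: m_def)
      thus ?thesis by (subst G_rec) (simp only: y_def power_add power_mult)
    qed
    have "w1 k = - 1" "w2 k = 1" "w1 (- k) = y ^ 3 * q ^ 3" "w2 (- k) = - (y ^ 3 * q ^ 2)"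
      using \<open>k > 0\<close> qm r by (simp_all add: w1_def w2_def r1_def r2_def numeral_eq_Suc)
    hence "D k + D (- k)
        = (X * y ^ 6 * q ^ 5 * (1 - (1 - y ^ 3 * q ^ 3) * G (Suc m))
            - X * y ^ 10 * q ^ 10 * (1 - (1 - y ^ 3 * q ^ 4) * G (Suc (Suc m)))
            - (- (X * y ^ 6 * q ^ 5) * G (Suc m) + X * y ^ 10 * q ^ 10 * G (Suc (Suc m))))
        + (X * y ^ 4 * q ^ 3 * (1 - (1 - y ^ 3 * q ^ 3) * G (Suc m))
            - X * (1 - (1 - y ^ 3 * q ^ 2) * G m)
            - (X * y ^ 4 * q ^ 3 * (y ^ 3 * q ^ 3) * G (Suc m) - X * (y ^ 3 * q ^ 2) * G m))"
      unfolding D_def R_theta r1_def r2_def r X_def[symmetric] a power_Suc qm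
      by (simp add: numeral_eq_Suc mult_ac)
    also have "\<dots> = 0"
      unfolding G G' by algebra
    finally show "D k + D (- k) = 0" .
  qed
  also have "D 0 = 2 * P"
    unfolding D_def R_theta r1_def r2_def w1_def w2_def P_eq_G0
    using G_rec[of 0] by (simp add: a1_def a2_def algebra_simps power2_eq_square numeral_eq_Suc)
  finally show ?thesis
    by (simp add: algebra_simps)
qed

end

theorem theorem1p1:
  fixes q :: complex
  assumes "norm q < 1"
  shows "qpoch_inf q * (chi0 q - 2) =
      (\<Sum>\<^sub>\<infinity>j::nat\<in>{0..}. \<Sum>m | - int j \<le> 3 * m \<and> 3 * m \<le> int j.
         sg m * (- 1) powi (m + int j + 1)
           * q powi (int j * (3 * int j + 1) div 2 - m * (15 * m + 1) div 2)
           * (1 - q ^ (2 * j + 1)))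
    + (\<Sum>\<^sub>\<infinity>j::nat\<in>{1..}. \<Sum>m | - int j - 1 \<le> 3 * m \<and> 3 * m \<le> int j - 1.
         sg m * (- 1) powi (m + int j + 1)
           * q powi (int j * (3 * int j + 1) div 2 - m * (15 * m + 11) div 2 - 1)
           * (1 - q ^ (2 * j + 1)))
    \<and> qpoch_inf q * chi1 q =
      (\<Sum>\<^sub>\<infinity>j::nat\<in>{1..}. \<Sum>m | - int j \<le> 3 * m \<and> 3 * m \<le> int j - 1.
         sg m * (- 1) powi (m + int j + 1)
           * q powi (int j * (3 * int j - 1) div 2 - m * (15 * m + 7) div 2 - 1)
           * (1 + q ^ j))
    + (\<Sum>\<^sub>\<infinity>j::nat\<in>{1..}. \<Sum>m | - int j - 1 \<le> 3 * m \<and> 3 * m \<le> int j - 2.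
         sg m * (- 1) powi (m + int j + 1)
           * q powi (int j * (3 * int j - 1) div 2 - m * (15 * m + 13) div 2 - 2)
           * (1 + q ^ j))"
proof -
  interpret unit_disc q
    by unfold_locales (rule assms)
  show ?thesis
    using hecke_chi0 hecke_chi1 by (rule conjI)
qed

end
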